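(* Let $\theta\in(0,1)$, $c>0$, and suppose $p_i=c\,i^{-1/\theta}\bigl(1+o(i^{-1/2})\bigr)$ as $i\to\infty$. Let $A$ satisfy the conditions stated in the context and, in addition, $A(t)=0$ for all $t\in[0,\delta]$ for some $\delta\in(0,1)$. Then, as $n\to\infty$, $$\sqrt{\mathbf E R_n}\,\bigl(\widehat\theta_n-\theta\bigr)-\int_0^1 t^{-\theta}Z_n(t)\,dA(t)\ \xrightarrow{\ p\ }\ 0 .$$
   Context: Model: words are drawn one by one, independently, from a countably infinite dictionary $\{1,2,\dots\}$, the $i$-th word being drawn with probability $p_i>0$, $\sum_i p_i=1$. For $j\ge1$, $R_j$ denotes the number of distinct words among the first $j$ draws; $R_0=0$. $[x]$ is the integer part of $x$, and $\log^+x=\max(\log x,0)$ (with $\log^+0=0$). The weight function $A:[0,1]\to\mathbb R$ is the sum of a step function and a piecewise continuously differentiable function on $[0,1]$, and satisfies $\int_0^1\log t\,dA(t)=1$ and $A(0)=A(0+)=A(1)=0$; integrals $\int\cdot\,dA$ are Lebesgue–Stieltjes integrals. The estimator is $\widehat\theta_n=\int_0^1\log^+R_{[nt]}\,dA(t)$. The process $Z_n$ is $Z_n(t)=\dfrac{R_{[nt]}-\mathbf E R_{[nt]}}{\sqrt{\mathbf E R_n}}$, $0\le t\le1$. *)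

theory Defs
  imports "HOL-Probability.Probability" "HOL-Library.Landau_Symbols"
begin

definition partition01 :: "real set \<Rightarrow> bool" where
  "partition01 D \<longleftrightarrow> finite D \<and> D \<subseteq> {0..1} \<and> 0 \<in> D \<and> 1 \<in> D"

definition consecutive :: "real set \<Rightarrow> real \<Rightarrow> real \<Rightarrow> bool" where
  "consecutive D a b \<longleftrightarrow> a \<in> D \<and> b \<in> D \<and> a < b \<and> {a<..<b} \<inter> D = {}"

definition step_fun01 :: "(real \<Rightarrow> real) \<Rightarrow> bool" where
  "step_fun01 S \<longleftrightarrow> (\<exists>D. partition01 D \<and>
     (\<forall>a b. consecutive D a b \<longrightarrow> (\<exists>v. \<forall>t\<in>{a<..<b}. S t = v)))"

definition piecewise_C1_01 :: "(real \<Rightarrow> real) \<Rightarrow> bool" where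
  "piecewise_C1_01 G \<longleftrightarrow> continuous_on {0..1} G \<and> (\<exists>D. partition01 D \<and>
     (\<forall>a b. consecutive D a b \<longrightarrow> (\<exists>G'. continuous_on {a..b} G' \<and>
        (\<forall>t\<in>{a..b}. (G has_real_derivative G' t) (at t within {a..b})))))"

definition admissible_weight :: "(real \<Rightarrow> real) \<Rightarrow> bool" where
  "admissible_weight A \<longleftrightarrow> (\<exists>S G. step_fun01 S \<and> piecewise_C1_01 G \<and>
     (\<forall>t\<in>{0..1}. A t = S t + G t))"

definition right_lim :: "(real \<Rightarrow> real) \<Rightarrow> real \<Rightarrow> real" where
  "right_lim A t = (if t = 1 then A 1 else Lim (at_right t) A)"

definition left_lim :: "(real \<Rightarrow> real) \<Rightarrow> real \<Rightarrow> real" where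
  "left_lim A t = (if t = 0 then A 0 else Lim (at_left t) A)"

definition jump :: "(real \<Rightarrow> real) \<Rightarrow> real \<Rightarrow> real" where
  "jump A t = right_lim A t - left_lim A t"

text \<open>Lebesgue--Stieltjes integral over [0,1] w.r.t. dA for an admissible A: the signed measure
  dA is the sum of point masses A(t+) - A(t-) at the (finitely many) jump points and the
  absolutely continuous part with density A'.\<close>
definition LS_integral :: "(real \<Rightarrow> real) \<Rightarrow> (real \<Rightarrow> real) \<Rightarrow> real" where
  "LS_integral A f =
     (\<Sum>t\<in>{t\<in>{0..1}. jump A t \<noteq> 0}. f t * jump A t)
     + (LINT t:{0..1}|lborel. f t * deriv A t)"

definition logp :: "real \<Rightarrow> real" where
  "logp x = (if x \<le> 0 then 0 else max (ln x) 0)"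

definition nwords :: "(nat \<Rightarrow> 'a \<Rightarrow> nat) \<Rightarrow> nat \<Rightarrow> 'a \<Rightarrow> nat" where
  "nwords X j \<omega> = card ((\<lambda>k. X k \<omega>) ` {..<j})"

end

theory Submission
  imports Defs
begin

text \<open>
  Write \<open>m n\<close> for the mean of \<open>R n\<close>. As \<open>dA\<close> has total mass 0 and integrates the logarithm to 1, the
  error of the estimator is the \<open>dA\<close>-integral of \<open>ln (1 + x t)\<close> with \<open>1 + x t = R[nt] / (t powr \<theta> * m n)\<close>.
  Linearizing the logarithm leaves the integral of \<open>t powr (-\<theta>) * Z n t\<close>, a quadratic remainder and a bias.
  Occupancies of different words are negatively correlated, so the variance of \<open>R j\<close> is at most
  \<open>m j\<close>; hence the remainder is of order \<open>1 / m n\<close> in mean.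
  The bias is negligible once \<open>m n = K * n powr \<theta> + o(n powr (\<theta>/2))\<close>: Poissonization costs \<open>O(1)\<close>, replacing
  \<open>p i\<close> by the exact power law costs \<open>o(n powr (\<theta>/2))\<close>, and the sum for the exact power law is within 1 of
  an integral that scales exactly like \<open>n powr \<theta>\<close>.
\<close>

section \<open>Asymptotics of the expected number of distinct words\<close>

text \<open>The error is multiplied by the square root of \<open>m n\<close>, which is of order
  \<open>n powr (\<theta>/2)\<close>, so a mean that is merely regularly varying would not do: the
  bias must be controlled on exactly that scale. This is what the rate
  \<open>o(i powr (-1/2))\<close> provides. After \<open>n\<close> draws the decisive words are
  those of rank up to about \<open>n powr \<theta>\<close>, and summing \<open>i powr (-1/2)\<close>
  over these ranks gives order \<open>n powr (\<theta>/2)\<close>. The constant \<open>K\<close> is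
  the product of Gamma(1 - \<theta>) and \<open>c powr \<theta>\<close>; it cancels when
  \<open>m\<close> at time \<open>nat \<lfloor>real n * t\<rfloor>\<close> is compared with
  \<open>t powr \<theta> * m n\<close>. The vanishing of \<open>A\<close> on [0, \<delta>] confines
  \<open>dA\<close> to [\<delta>, 1], where \<open>ln\<close> and \<open>t powr (-\<theta>)\<close>
  are bounded and every count is at least the one at time \<delta>.\<close>

lemma telescoping_sum_le:
  fixes f F :: "nat \<Rightarrow> real"
  assumes "\<And>i. 0 \<le> f i" "\<And>i. f i \<le> F (Suc i) - F i" "\<And>i. F i \<le> L"
  shows "summable f" "(\<Sum>i. f i) \<le> L - F 0"
proof -
  have s: "(\<Sum>i<n. f i) \<le> L - F 0" for n
  proof -
    have "(\<Sum>i<n. f i) \<le> (\<Sum>i<n. F (Suc i) - F i)" by (intro sum_mono assms)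
    also have "\<dots> = F n - F 0" by (rule sum_lessThan_telescope)
    finally show ?thesis using assms(3)[of n] by linarith
  qed
  show "summable f" using s assms(1) by (intro summableI_nonneg_bounded[of f]) auto
  then show "(\<Sum>i. f i) \<le> L - F 0" using s by (intro suminf_le_const)
qed

lemma exp_minus_mult_le_one: "x * exp (-x) \<le> (1::real)"
proof -
  have "x \<le> exp x" using exp_ge_add_one_self[of x] by linarith
  then show ?thesis by (simp add: exp_minus field_simps)
qed

text \<open>This is the cost of Poissonization for one word of probability \<open>x\<close>. The
  bound is linear in \<open>x\<close> and uniform in \<open>n\<close>, so its sum over all words is
  bounded. The bases \<open>exp (-x)\<close> and \<open>1 - x\<close> differ by at most the square
  of \<open>x\<close>; passing to powers costs a factor of order \<open>n\<close>, and the surplus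
  \<open>n * x\<close> is absorbed by \<open>exp (- (n * x))\<close>.\<close>

lemma power_one_minus_vs_exp:
  fixes x :: real
  assumes "0 \<le> x" "x \<le> 1"
  shows "\<bar>exp (- (real n * x)) - (1 - x) ^ n\<bar> \<le> 3 * x"
proof (cases n)
  case (Suc m)
  define a where "a = exp (-x)"
  define b where "b = 1 - x"
  have b: "0 \<le> b" "b \<le> a" using assms exp_ge_add_one_self[of "-x"] by (auto simp: a_def b_def)
  have ab: "a - b \<le> x\<^sup>2"
  proof -
    have "exp (-x) * (1 + x) \<le> exp (-x) * exp x" using exp_ge_add_one_self[of x] by (intro mult_left_mono) auto
    also have "\<dots> = 1" by (simp flip: exp_add)
    \<comment> \<open>The product on the right is \<open>1 + x ^ 3\<close>.\<close>
    also have "\<dots> \<le> (1 - x + x\<^sup>2) * (1 + x)" using assms by (simp add: power2_eq_square algebra_simps)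
    finally show ?thesis using assms by (simp add: a_def b_def)
  qed
  have "b ^ n \<le> a ^ n" using b by (intro power_mono)
  moreover have "a ^ n - b ^ n \<le> (a - b) * (n * a ^ m)"
  proof -
    have "a ^ n - b ^ n = (a - b) * (\<Sum>i<n. a ^ i * b ^ (m - i))"
      unfolding Suc by (subst power_diff_sumr2) (auto intro!: sum.cong simp: mult.commute)
    also have "\<dots> \<le> (a - b) * (\<Sum>i<n. a ^ m)"
    proof (intro mult_left_mono sum_mono)
      fix i assume "i \<in> {..<n}"
      then have "i \<le> m" using Suc by auto
      have "a ^ i * b ^ (m - i) \<le> a ^ i * a ^ (m - i)" using b by (intro mult_left_mono power_mono) (auto simp: a_def)
      also have "\<dots> = a ^ m" using \<open>i \<le> m\<close> by (simp flip: power_add)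
      finally show "a ^ i * b ^ (m - i) \<le> a ^ m" .
    qed (use b in auto)
    finally show ?thesis by simp
  qed
  moreover have "(a - b) * (n * a ^ m) \<le> x\<^sup>2 * (n * a ^ m)"
    using ab by (intro mult_right_mono) (auto simp: a_def)
  \<comment> \<open>One factor \<open>n * x\<close> is set apart for
    \<open>exp_minus_mult_le_one\<close>. The exponent is \<open>m = n - 1\<close>, and replacing it
    by \<open>n\<close> costs \<open>exp x\<close>, which is at most 3.\<close>
  moreover have "x\<^sup>2 * (n * a ^ m) = x * exp x * ((n * x) * exp (- (n * x)))"
  proof -
    have "a ^ m = exp x * exp (- (n * x))"
      unfolding a_def Suc by (simp add: algebra_simps flip: exp_of_nat_mult exp_add)
    then show ?thesis by (simp add: power2_eq_square)
  qed
  moreover have "x * exp x * ((n * x) * exp (- (n * x))) \<le> x * 3 * 1"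
  proof (intro mult_mono)
    have "exp x \<le> exp 1" using assms by simp
    then show "exp x \<le> 3" using exp_le by linarith
  qed (use assms exp_minus_mult_le_one in auto)
  moreover have "a ^ n = exp (- (real n * x))" unfolding a_def by (simp flip: exp_of_nat_mult)
  ultimately show ?thesis unfolding b_def[symmetric] by simp
qed (use assms in auto)

text \<open>The factor \<open>u / (u + x)\<close> is a smooth cutoff at \<open>x = u\<close>,
  comparable to the minimum of 1 and \<open>u / x\<close>. With it the weighted summand has an
  elementary antiderivative, so the order \<open>sqrt u\<close> comes out of one integral
  comparison, with no splitting of the sum at \<open>u\<close>.\<close>

lemma sum_inv_sqrt_cutoff:
  fixes u :: real
  assumes u: "u > 0"
  defines "h \<equiv> \<lambda>i::nat. real (Suc i) powr (-1/2) * (u / (u + real (Suc i)))"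
  shows "summable h" "(\<Sum>i. h i) \<le> pi * sqrt u"
proof -
  \<comment> \<open>an antiderivative of the summand, vanishing at 0 and bounded by \<open>pi * sqrt u\<close>\<close>
  define F where "F = (\<lambda>x::real. 2 * sqrt u * arctan (sqrt (x / u)))"
  have le: "h i \<le> F (real (Suc i)) - F (real i)" for i
  proof -
    obtain z where z: "real i < z" "z < real (Suc i)" "F (real (Suc i)) - F (real i) = (z powr (-1/2) * (u / (u + z))) * (real (Suc i) - real i)"
    proof (rule mvt)
      show "real i < real (Suc i)" by simp
      show "continuous_on {real i..real (Suc i)} F" unfolding F_def using u by (intro continuous_intros) auto
      \<comment> \<open>The mean value theorem asks for a derivative at interior points only. Hence
        the first interval, which starts at 0, is covered although \<open>F\<close> has infinite
        slope there.\<close>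
      fix x assume x: "real i < x"
      have s: "sqrt (x/u) = sqrt x / sqrt u" "(sqrt x / sqrt u)\<^sup>2 = x / u" "\<not> x / u < 0"
        using x u by (auto simp: real_sqrt_divide power_divide not_less)
      have p: "x powr (- (1 / 2)) = 1 / sqrt x" using x by (simp add: powr_minus powr_half_sqrt field_simps)
      have "sqrt u * sqrt u = u" using u by simp
      then have e: "inverse (1 + x / u) * (sqrt u * sqrt u) / (sqrt x * u) = u / (sqrt x * (u + x))"
        using x u by (simp add: divide_simps)
      have "(F has_real_derivative (x powr (-1/2) * (u / (u + x)))) (at x)"
        unfolding F_def
        using x u p e by (auto intro!: derivative_eq_intros simp: s)
      then show "(F has_derivative (*) (x powr (-1/2) * (u / (u + x)))) (at x)"
        by (simp add: has_field_derivative_def)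
    qed
    have "h i \<le> z powr (-1/2) * (u / (u + z))" unfolding h_def
      using z u by (intro mult_mono powr_mono2' divide_left_mono) auto
    then show ?thesis using z by simp
  qed
  have bd: "F x \<le> pi * sqrt u" for x
    using arctan_ubound[of "sqrt (x/u)"] u by (simp add: F_def field_simps)
  have "h i \<ge> 0" for i using u by (simp add: h_def)
  note * = telescoping_sum_le[of h "\<lambda>i. F (real i)", OF this le bd]
  show "summable h" by (rule *)
  show "(\<Sum>i. h i) \<le> pi * sqrt u" using *(2) by (simp add: F_def)
qed

text \<open>With \<open>u = a powr \<theta>\<close> the truncated factor is the minimum of 1 and
  \<open>(u / x) powr (1/\<theta>)\<close>. As \<open>1/\<theta>\<close> exceeds 1, it is at most
  the minimum of 1 and \<open>u / x\<close>, hence at most twice the smooth cutoff. The exponent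
  \<theta>/2 arises as the square root of \<open>u\<close>.\<close>

lemma truncated_weight_sum:
  fixes a \<theta> :: real
  assumes \<theta>: "0 < \<theta>" "\<theta> < 1" and a: "a > 0"
  shows "summable (\<lambda>i. real (Suc i) powr (-1/2) * min 1 (a * real (Suc i) powr (-1/\<theta>)))"
    and "(\<Sum>i. real (Suc i) powr (-1/2) * min 1 (a * real (Suc i) powr (-1/\<theta>))) \<le> 2 * pi * a powr (\<theta>/2)"
proof -
  define u where "u = a powr \<theta>"
  have u: "u > 0" using a by (simp add: u_def)
  define h where "h = (\<lambda>i::nat. real (Suc i) powr (-1/2) * (u / (u + real (Suc i))))"
  note h = sum_inv_sqrt_cutoff[OF u, folded h_def]
  have le: "real (Suc i) powr (-1/2) * min 1 (a * real (Suc i) powr (-1/\<theta>)) \<le> 2 * h i" for i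
  proof -
    define x where "x = real (Suc i)"
    have x: "x > 0" by (simp add: x_def)
    have eq: "a * x powr (-1/\<theta>) = (u / x) powr (1/\<theta>)"
      using a x \<theta> by (simp add: u_def powr_divide powr_powr powr_minus field_simps)
    have "min 1 ((u / x) powr (1/\<theta>)) \<le> 2 * (u / (u + x))"
    proof (cases "u \<le> x")
      case True
      have "(u / x) powr (1/\<theta>) \<le> (u / x) powr 1"
        using True u x \<theta> by (intro powr_mono') (auto simp: field_simps)
      also have "\<dots> \<le> 2 * (u / (u + x))" using True u x by (simp add: field_simps)
      finally show ?thesis by simp
    next
      case False
      then have "1 \<le> 2 * (u / (u + x))" using u x by (simp add: field_simps)
      then show ?thesis by simp
    qed
    then have "x powr (-1/2) * min 1 (a * x powr (-1/\<theta>)) \<le> x powr (-1/2) * (2 * (u / (u + x)))"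
      unfolding eq by (intro mult_left_mono) auto
    then show ?thesis unfolding h_def x_def by (simp only: mult.left_commute)
  qed
  show s: "summable (\<lambda>i. real (Suc i) powr (-1/2) * min 1 (a * real (Suc i) powr (-1/\<theta>)))"
    by (rule summable_comparison_test[of _ "\<lambda>i. 2 * h i"]) (use le h a in \<open>auto intro!: exI[of _ 0] summable_mult\<close>)
  have "(\<Sum>i. real (Suc i) powr (-1/2) * min 1 (a * real (Suc i) powr (-1/\<theta>))) \<le> (\<Sum>i. 2 * h i)"
    by (intro suminf_le le s summable_mult h)
  also have "\<dots> = 2 * (\<Sum>i. h i)" by (intro suminf_mult h)
  also have "\<dots> \<le> 2 * (pi * sqrt u)" using h by simp
  also have "sqrt u = a powr (\<theta>/2)" using a by (simp add: u_def powr_powr flip: powr_half_sqrt)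
  finally show "(\<Sum>i. real (Suc i) powr (-1/2) * min 1 (a * real (Suc i) powr (-1/\<theta>))) \<le> 2 * pi * a powr (\<theta>/2)" by simp
qed

text \<open>The slope of \<open>exp\<close> is taken at the smaller argument, and a relative error
  of at most 1/2 keeps that argument above \<open>y/2\<close>. The minimum serves both regimes: for
  frequent words the exponential decay absorbs \<open>y\<close>, for rare words the bound is
  proportional to \<open>y\<close>.\<close>

lemma exp_minus_diff_le:
  fixes x y e :: real
  assumes "0 \<le> y" "\<bar>x - y\<bar> \<le> e * y" "0 \<le> e" "e \<le> 1/2"
  shows "\<bar>exp (-x) - exp (-y)\<bar> \<le> 2 * e * min 1 y"
proof -
  define z where "z = min x y"
  have z: "y/2 \<le> z" 
  proof -
    have "e * y \<le> 1/2 * y" using assms by (intro mult_right_mono) auto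
    then show ?thesis using assms by (auto simp: z_def min_def abs_le_iff)
  qed
  have "\<bar>exp (-x) - exp (-y)\<bar> \<le> \<bar>x - y\<bar> * exp (-z)"
  proof (cases "x \<le> y")
    case True
    have "1 - (y - x) \<le> exp (- (y - x))" by (metis exp_ge_add_one_self uminus_add_conv_diff add.commute)
    then have "exp (-x) * (1 - (y - x)) \<le> exp (-x) * exp (- (y - x))" by (intro mult_left_mono) auto
    then have "exp (-x) - exp (-y) \<le> (y - x) * exp (-x)" by (simp add: algebra_simps flip: exp_add)
    then show ?thesis using True by (simp add: z_def min_def)
  next
    case False
    have "1 - (x - y) \<le> exp (- (x - y))" by (metis exp_ge_add_one_self uminus_add_conv_diff add.commute)
    then have "exp (-y) * (1 - (x - y)) \<le> exp (-y) * exp (- (x - y))" by (intro mult_left_mono) auto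
    then have "exp (-y) - exp (-x) \<le> (x - y) * exp (-y)" by (simp add: algebra_simps flip: exp_add)
    then show ?thesis using False by (simp add: z_def min_def)
  qed
  also have "\<dots> \<le> e * y * exp (-(y/2))" using assms z by (intro mult_mono) auto
  also have "y * exp (-(y/2)) \<le> 2 * min 1 y"
  proof -
    have "y * exp (-(y/2)) \<le> y" using assms by (simp add: mult_left_le)
    moreover have "y * exp (-(y/2)) \<le> 2" using exp_minus_mult_le_one[of "y/2"] by simp
    ultimately show ?thesis using assms by (auto simp: min_def)
  qed
  then have "e * y * exp (-(y/2)) \<le> e * (2 * min 1 y)" using assms(3) by (simp add: mult.assoc mult_left_mono)
  finally show ?thesis by simp
qed

text \<open>An error \<open>o(n powr (\<theta>/2))\<close> is expressed by an arbitrary \<eta> and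
  an additive \<open>B\<close>. The constant pays for the finitely many words whose probabilities
  are not yet close to the power law, each at a cost of at most 1. For every other word the relative
  error \<open>\<epsilon> * i powr (-1/2)\<close> feeds \<open>truncated_weight_sum\<close> with
  \<open>a = n * c\<close>.\<close>

lemma poisson_sum_perturbation:
  fixes p :: "nat \<Rightarrow> real" and \<theta> c :: real
  assumes p: "\<And>i. 0 \<le> p i" and \<theta>: "0 < \<theta>" "\<theta> < 1" and c: "c > 0"
    and asym: "(\<lambda>i. p i / (c * real i powr (-1/\<theta>)) - 1) \<in> o(\<lambda>i. real i powr (-1/2))"
    and \<eta>: "\<eta> > 0"
  obtains B where "\<And>n. summable (\<lambda>i. \<bar>exp (- (real n * p (Suc i))) - exp (- (real n * (c * real (Suc i) powr (-1/\<theta>))))\<bar>)"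
    and "\<And>n. (\<Sum>i. \<bar>exp (- (real n * p (Suc i))) - exp (- (real n * (c * real (Suc i) powr (-1/\<theta>))))\<bar>)
       \<le> \<eta> * real n powr (\<theta>/2) + B"
proof -
  \<comment> \<open>\<open>k\<close> is the product of the 2 of \<open>exp_minus_diff_le\<close>,
    the \<open>2 * pi\<close> of \<open>truncated_weight_sum\<close> and the power of
    \<open>c\<close>. The cap 1/2 on \<epsilon> is a hypothesis of
    \<open>exp_minus_diff_le\<close>.\<close>
  define k where "k = 4 * pi * c powr (\<theta>/2)"
  have k: "k > 0" using c by (simp add: k_def)
  define \<epsilon> where "\<epsilon> = min (1/2) (\<eta> / k)"
  have \<epsilon>: "\<epsilon> > 0" "\<epsilon> \<le> 1/2" "\<epsilon> * k \<le> \<eta>" using \<eta> k by (auto simp: \<epsilon>_def min_def field_simps)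
  define q where "q = (\<lambda>i. c * real (Suc i) powr (-1/\<theta>))"
  have q: "q i > 0" for i using c by (simp add: q_def)
  obtain N where N: "\<And>i. i \<ge> N \<Longrightarrow> \<bar>p i / (c * real i powr (-1/\<theta>)) - 1\<bar> \<le> \<epsilon> * real i powr (-1/2)"
    using landau_o.smallD[OF asym \<epsilon>(1)] by (auto simp: eventually_at_top_linorder)
  define d where "d = (\<lambda>n i. \<bar>exp (- (real n * p (Suc i))) - exp (- (real n * q i))\<bar>)"
  define h where "h = (\<lambda>n i. real (Suc i) powr (-1/2) * min 1 (real n * c * real (Suc i) powr (-1/\<theta>)))"
  define F where "F = (\<lambda>i. if i \<in> {..<N} then 1 else 0 :: real)"
  have F: "summable F" "(\<Sum>i. F i) = N" 
    unfolding F_def using sums_If_finite_set[of "{..<N}" "\<lambda>_. 1::real"] 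
    by (auto simp: sums_iff)
  have le: "d n i \<le> F i + 2 * \<epsilon> * h n i" for n i
  proof (cases "i < N")
    case True
    have "d n i \<le> 1"
    proof -
      have "exp (- (real n * p (Suc i))) \<in> {0..1}" "exp (- (real n * q i)) \<in> {0..1}"
        using p[of "Suc i"] q[of i] by auto
      then show ?thesis unfolding d_def atLeastAtMost_iff abs_le_iff by linarith
    qed
    moreover have "h n i \<ge> 0" using c by (simp add: h_def)
    then have "0 \<le> 2 * \<epsilon> * h n i" using \<epsilon> by simp
    ultimately show ?thesis using True by (simp add: F_def)
  next
    case False
    define r where "r = real (Suc i) powr (-1/2)"
    have r: "0 \<le> r" "r \<le> 1" using ge_one_powr_ge_zero[of "real (Suc i)" "1/2"] 
      by (auto simp: r_def powr_minus field_simps)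
    have "\<bar>p (Suc i) / q i - 1\<bar> \<le> \<epsilon> * r" using N[of "Suc i"] False by (simp add: r_def q_def)
    moreover have "p (Suc i) / q i - 1 = (p (Suc i) - q i) / q i" using q[of i] by (simp add: field_simps)
    ultimately have "\<bar>p (Suc i) - q i\<bar> \<le> \<epsilon> * r * q i" using q[of i] by (simp add: field_simps)
    then have "real n * \<bar>p (Suc i) - q i\<bar> \<le> real n * (\<epsilon> * r * q i)" by (intro mult_left_mono) auto
    moreover have "\<bar>real n * p (Suc i) - real n * q i\<bar> = real n * \<bar>p (Suc i) - q i\<bar>"
      by (simp add: abs_mult flip: right_diff_distrib)
    ultimately have "\<bar>real n * p (Suc i) - real n * q i\<bar> \<le> (\<epsilon> * r) * (real n * q i)"
      by (simp add: mult_ac)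
    moreover have "\<epsilon> * r \<le> 1/2" using \<epsilon> r mult_mono[of \<epsilon> "1/2" r 1] by simp
    ultimately have "d n i \<le> 2 * (\<epsilon> * r) * min 1 (real n * q i)"
      unfolding d_def using q[of i] \<epsilon> r by (intro exp_minus_diff_le) auto
    then show ?thesis using False by (simp add: F_def h_def r_def q_def mult_ac)
  qed
  have h: "summable (h n)" "(\<Sum>i. h n i) \<le> 2 * pi * (real n * c) powr (\<theta>/2)" for n
  proof -
    have "summable (h n) \<and> (\<Sum>i. h n i) \<le> 2 * pi * (real n * c) powr (\<theta>/2)"
    proof (cases "n = 0")
      case False
      then show ?thesis unfolding h_def using truncated_weight_sum[OF \<theta>, of "real n * c"] c by simp
    qed (simp add: h_def)
    then show "summable (h n)" "(\<Sum>i. h n i) \<le> 2 * pi * (real n * c) powr (\<theta>/2)" by auto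
  qed
  have s: "summable (\<lambda>i. F i + 2 * \<epsilon> * h n i)" for n by (intro summable_add summable_mult F h)
  have sd: "summable (d n)" for n
    by (rule summable_comparison_test[OF _ s[of n]]) (use le in \<open>auto simp: d_def\<close>)
  have "(\<Sum>i. d n i) \<le> \<eta> * real n powr (\<theta>/2) + N" for n
  proof -
    have "(\<Sum>i. d n i) \<le> (\<Sum>i. F i + 2 * \<epsilon> * h n i)" by (intro suminf_le le sd s)
    also have "\<dots> = N + 2 * \<epsilon> * (\<Sum>i. h n i)"
      using F h by (subst suminf_add[symmetric]) (auto intro: summable_mult simp: suminf_mult)
    also have "2 * \<epsilon> * (\<Sum>i. h n i) \<le> 2 * \<epsilon> * (2 * pi * (real n * c) powr (\<theta>/2))"
      using \<epsilon> h[of n] by (intro mult_left_mono) auto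
    also have "\<dots> = (\<epsilon> * k) * real n powr (\<theta>/2)" using c by (simp add: k_def powr_mult mult_ac)
    also have "\<dots> \<le> \<eta> * real n powr (\<theta>/2)" using \<epsilon> by (intro mult_right_mono) auto
    finally show ?thesis by simp
  qed
  with sd show ?thesis using that unfolding d_def q_def by blast
qed

text \<open>With \<open>u = a powr \<theta>\<close> the summand is a decreasing function \<phi> at
  the points \<open>(i + 1) / u\<close>. So the sum is \<open>u\<close> times a right-endpoint
  Riemann sum of mesh \<open>1 / u\<close>, and it misses \<open>u\<close> times the integral of
  \<phi> by at most one cell, that is by \<open>\<phi> 0 = 1\<close>.\<close>

lemma poisson_sum_power_law:
  fixes \<theta> :: real
  assumes \<theta>: "0 < \<theta>" "\<theta> < 1"
  obtains K :: real where "K > 0"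
    "\<And>a. a > 0 \<Longrightarrow> summable (\<lambda>i. 1 - exp (- (a * real (Suc i) powr (-1/\<theta>))))"
    "\<And>a. a > 0 \<Longrightarrow> \<bar>(\<Sum>i. 1 - exp (- (a * real (Suc i) powr (-1/\<theta>)))) - K * a powr \<theta>\<bar> \<le> 1"
proof -
  \<comment> \<open>the value 1 at 0 is the continuous extension; the formula itself gives 0 there, as \<open>0 powr y = 0\<close>\<close>
  define \<phi> where "\<phi> = (\<lambda>x::real. if x \<le> 0 then 1 else 1 - exp (- (x powr (-1/\<theta>))))"
  have \<phi>01: "0 \<le> \<phi> x" "\<phi> x \<le> 1" for x by (auto simp: \<phi>_def)
  have anti: "\<phi> y \<le> \<phi> x" if "x \<le> y" for x y :: real
  proof (cases "x \<le> 0")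
    case True then show ?thesis using \<phi>01 by (simp add: \<phi>_def)
  next
    case False
    then have "y powr (-1/\<theta>) \<le> x powr (-1/\<theta>)" using that \<theta> by (intro powr_mono2') auto
    then show ?thesis using False that by (simp add: \<phi>_def)
  qed
  \<comment> \<open>Applying \<open>exp (-y) \<le> 1 / y\<close> at
    \<open>y = x powr (-1/\<theta>)\<close> gives
    \<open>1 - \<phi> x \<le> x powr (1/\<theta>)\<close>, which is at most \<open>x\<close>. This
    yields continuity at 0.\<close>
  have near0: "1 - x \<le> \<phi> x" if "0 \<le> x" "x \<le> 1" for x
  proof (cases "x = 0")
    case False
    then have x: "0 < x" using that by simp
    have "x powr (-1/\<theta>) \<le> exp (x powr (-1/\<theta>))"
      using exp_ge_add_one_self[of "x powr (-1/\<theta>)"] by linarith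
    then have "inverse (exp (x powr (-1/\<theta>))) \<le> inverse (x powr (-1/\<theta>))"
      using x by (intro le_imp_inverse_le) simp_all
    also have "\<dots> = x powr (1/\<theta>)" using x by (simp flip: powr_minus)
    also have "\<dots> \<le> x powr 1" using x that \<theta> by (intro powr_mono') auto
    finally show ?thesis using x by (simp add: \<phi>_def exp_minus)
  qed (simp add: \<phi>_def)
  have upper: "\<phi> x \<le> x powr (-1/\<theta>)" if "x > 0" for x
    using exp_ge_add_one_self[of "- (x powr (-1/\<theta>))"] that by (simp add: \<phi>_def)
  have cont: "continuous_on {0..b} \<phi>" for b
    unfolding continuous_on_def
  proof
    fix x assume x: "x \<in> {0..b}"
    show "(\<phi> \<longlongrightarrow> \<phi> x) (at x within {0..b})"
    proof (cases "x = 0")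
      case True
      have "(\<phi> \<longlongrightarrow> 1) (at 0 within {0..b})"
      proof (rule tendsto_sandwich[where f="\<lambda>x. 1 - x" and h="\<lambda>_. 1"])
        show "((\<lambda>x. 1 - x) \<longlongrightarrow> 1) (at 0 within {0..b})" by (auto intro!: tendsto_eq_intros)
        show "\<forall>\<^sub>F x in at 0 within {0..b}. 1 - x \<le> \<phi> x"
          unfolding eventually_at by (rule exI[of _ 1]) (use near0 in \<open>auto simp: dist_real_def\<close>)
      qed (use \<phi>01 in auto)
      then show ?thesis using True by (simp add: \<phi>_def)
    next
      case False
      then have x: "0 < x" using x by auto
      have "isCont (\<lambda>x. 1 - exp (- (x powr (-1/\<theta>)))) x" using x by (intro continuous_intros) auto
      then have "((\<lambda>x. 1 - exp (- (x powr (-1/\<theta>)))) \<longlongrightarrow> \<phi> x) (at x)" using x by (simp add: isCont_def \<phi>_def)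
      then have "(\<phi> \<longlongrightarrow> \<phi> x) (at x)"
        by (rule Lim_transform_within_open[of _ _ _ _ "{0<..}"]) (use x in \<open>auto simp: \<phi>_def\<close>)
      then show ?thesis by (rule tendsto_within_subset) auto
    qed
  qed
  define \<Psi> where "\<Psi> = (\<lambda>x. integral {0..x} \<phi>)"
  have deriv: "(\<Psi> has_real_derivative \<phi> t) (at t within {0..b})" if "t \<in> {0..b}" for t b :: real
    unfolding \<Psi>_def by (rule integral_has_real_derivative[OF cont that])
  have deriv': "(\<Psi> has_real_derivative \<phi> t) (at t)" if "0 < t" for t :: real
    using deriv[of t "t+1"] that at_within_Icc_at[of 0 t "t+1"] by simp
  have mv: "\<phi> y * (y - x) \<le> \<Psi> y - \<Psi> x" "\<Psi> y - \<Psi> x \<le> \<phi> x * (y - x)" if xy: "0 \<le> x" "x < y" for x y :: real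
  proof -
    have "continuous_on {0..y} \<Psi>" using deriv by (intro DERIV_continuous_on) auto
    then have c: "continuous_on {x..y} \<Psi>" by (rule continuous_on_subset) (use xy in auto)
    have d: "(\<Psi> has_derivative (\<lambda>h. \<phi> t * h)) (at t)" if "x < t" "t < y" for t
      using deriv'[of t] that xy by (simp add: has_field_derivative_def)
    obtain z where z: "x < z" "z < y" "\<Psi> y - \<Psi> x = \<phi> z * (y - x)"
      by (rule mvt[OF xy(2) c d])
    then show "\<phi> y * (y - x) \<le> \<Psi> y - \<Psi> x" "\<Psi> y - \<Psi> x \<le> \<phi> x * (y - x)"
      using anti[of x z] anti[of z y] that by (auto intro!: mult_right_mono)
  qed
  have \<Psi>0: "\<Psi> 0 = 0" by (simp add: \<Psi>_def)
  have mono: "\<Psi> x \<le> \<Psi> y" if "0 \<le> x" "x \<le> y" for x y :: real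
    using mv(1)[of x y] that mult_nonneg_nonneg[OF \<phi>01(1)[of y], of "y - x"] by (cases "x = y") auto
  define L where "L = \<Psi> 1 + \<theta> / (1 - \<theta>)"
  have bdd: "\<Psi> x \<le> L" if "0 \<le> x" for x :: real
  proof (cases "x \<le> 1")
    case True
    then show ?thesis using mono[OF that True] \<theta> by (simp add: L_def add_increasing2)
  next
    case False
    \<comment> \<open>The added term is the integral of \<open>t powr (-1/\<theta>)\<close> from
      \<open>x\<close> to infinity, finite because \<theta> is below 1. Its derivative outweighs
      \<phi> by \<open>upper\<close>, so \<Theta> decreases on [1, \<infinity>); \<open>L\<close> is
      its value at 1.\<close>
    define \<Theta> where "\<Theta> = (\<lambda>x. \<Psi> x + \<theta> / (1 - \<theta>) * x powr (1 - 1/\<theta>))"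
    have "\<Theta> x \<le> \<Theta> 1"
    proof (rule DERIV_nonpos_imp_nonincreasing[of 1 x \<Theta>])
      fix t :: real assume "1 \<le> t"
      have "(\<Theta> has_real_derivative (\<phi> t + \<theta> / (1 - \<theta>) * ((1 - 1/\<theta>) * t powr (1 - 1/\<theta> - 1)))) (at t)"
        unfolding \<Theta>_def using \<open>1 \<le> t\<close> by (intro DERIV_add deriv' DERIV_cmult has_real_derivative_powr) auto
      moreover have "\<theta> / (1 - \<theta>) * ((1 - 1/\<theta>) * t powr (1 - 1/\<theta> - 1)) = - (t powr (-1/\<theta>))"
      proof -
        have "\<theta> / (1 - \<theta>) * (1 - 1/\<theta>) = -1" using \<theta> by (simp add: field_simps)
        then show ?thesis by (simp flip: mult.assoc)
      qed
      ultimately show "\<exists>y. (\<Theta> has_real_derivative y) (at t) \<and> y \<le> 0"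
        using upper[of t] \<open>1 \<le> t\<close> by (intro exI[of _ "\<phi> t - t powr (-1/\<theta>)"]) auto
    qed (use False in auto)
    then have "\<Psi> x + \<theta> / (1 - \<theta>) * x powr (1 - 1/\<theta>) \<le> L" by (simp add: \<Theta>_def L_def)
    moreover have "0 \<le> \<theta> / (1 - \<theta>) * x powr (1 - 1/\<theta>)" using \<theta> by simp
    ultimately show ?thesis by linarith
  qed
  \<comment> \<open>As \<Psi> is monotone and bounded, the supremum is the improper integral of
    \<phi> over the half-line, that is Gamma(1 - \<theta>).\<close>
  define K where "K = (SUP x\<in>{0..}. \<Psi> x)"
  have bA: "bdd_above (\<Psi> ` {0..})" using bdd by (auto intro!: bdd_aboveI[of _ L])
  have K: "\<Psi> x \<le> K" if "0 \<le> x" for x unfolding K_def using that by (intro cSUP_upper bA) auto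
  have Kpos: "K > 0"
  proof -
    have "0 < \<phi> 1 * (1 - 0)" by (simp add: \<phi>_def)
    also have "\<dots> \<le> \<Psi> 1" using mv(1)[of 0 1] \<Psi>0 by simp
    also have "\<dots> \<le> K" by (rule K) simp
    finally show ?thesis .
  qed
  have "summable (\<lambda>i. 1 - exp (- (a * real (Suc i) powr (-1/\<theta>)))) \<and>
      \<bar>(\<Sum>i. 1 - exp (- (a * real (Suc i) powr (-1/\<theta>)))) - K * a powr \<theta>\<bar> \<le> 1" if a: "a > 0" for a
  proof -
    define u where "u = a powr \<theta>"
    have u: "u > 0" using a by (simp add: u_def)
    define f where "f = (\<lambda>i. 1 - exp (- (a * real (Suc i) powr (-1/\<theta>))))"
    have f: "f i = \<phi> (real (Suc i) / u)" for i
    proof -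
      have "a * real (Suc i) powr (-1/\<theta>) = (real (Suc i) / u) powr (-1/\<theta>)"
        using a \<theta> by (simp add: u_def powr_divide powr_powr powr_minus field_simps)
      moreover have "0 < real (Suc i) / u" using u by simp
      ultimately show ?thesis unfolding f_def \<phi>_def by (simp only: not_le[symmetric] if_False)
    qed
    have le1: "f i \<le> u * \<Psi> (real (Suc i) / u) - u * \<Psi> (real i / u)" for i
    proof -
      have "\<phi> (real (Suc i) / u) * (real (Suc i) / u - real i / u) \<le> \<Psi> (real (Suc i) / u) - \<Psi> (real i / u)"
        using u by (intro mv) (auto simp: divide_strict_right_mono)
      then have "u * (\<phi> (real (Suc i) / u) * (real (Suc i) / u - real i / u)) \<le> u * (\<Psi> (real (Suc i) / u) - \<Psi> (real i / u))"
        using u by (intro mult_left_mono) auto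
      moreover have "u * (real (Suc i) / u - real i / u) = 1" using u by (simp add: field_simps)
      ultimately show ?thesis unfolding f by (metis (no_types, opaque_lifting) mult.left_commute mult.right_neutral right_diff_distrib)
    qed
    have le2: "u * \<Psi> (real (Suc (Suc i)) / u) - u * \<Psi> (real (Suc i) / u) \<le> f i" for i
    proof -
      have "\<Psi> (real (Suc (Suc i)) / u) - \<Psi> (real (Suc i) / u) \<le> \<phi> (real (Suc i) / u) * (real (Suc (Suc i)) / u - real (Suc i) / u)"
        using u by (intro mv) (auto simp: divide_strict_right_mono)
      then have "u * (\<Psi> (real (Suc (Suc i)) / u) - \<Psi> (real (Suc i) / u)) \<le> u * (\<phi> (real (Suc i) / u) * (real (Suc (Suc i)) / u - real (Suc i) / u))"
        using u by (intro mult_left_mono) auto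
      moreover have "u * (real (Suc (Suc i)) / u - real (Suc i) / u) = 1" using u by (simp add: field_simps)
      ultimately show ?thesis unfolding f by (metis (no_types, opaque_lifting) mult.left_commute mult.right_neutral right_diff_distrib)
    qed
    have f0: "0 \<le> f i" for i unfolding f by (rule \<phi>01)
    have "u * \<Psi> (real i / u) \<le> u * K" for i using u by (intro mult_left_mono K) auto
    note tele = telescoping_sum_le[of f "\<lambda>i. u * \<Psi> (real i / u)", OF f0 le1 this]
    have up: "(\<Sum>i. f i) \<le> K * u" using tele(2) \<Psi>0 by (simp add: mult.commute)
    \<comment> \<open>In \<open>le2\<close> each term is compared with the cell to its right, so the
      cell [0, 1/u] is left over. Since \<phi> is at most 1, it contributes at most 1 after
      multiplication by \<open>u\<close>.\<close>
    have low: "u * \<Psi> (real (Suc n) / u) - 1 \<le> (\<Sum>i. f i)" for n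
    proof -
      have "u * \<Psi> (1 / u) \<le> 1"
      proof -
        have "\<Psi> (1/u) - \<Psi> 0 \<le> \<phi> 0 * (1/u - 0)" using u by (intro mv) auto
        then show ?thesis using u \<Psi>0 by (simp add: \<phi>_def field_simps)
      qed
      moreover have "(\<Sum>i<n. u * \<Psi> (real (Suc (Suc i)) / u) - u * \<Psi> (real (Suc i) / u)) = u * \<Psi> (real (Suc n) / u) - u * \<Psi> (real (Suc 0) / u)"
        by (rule sum_lessThan_telescope[of "\<lambda>i. u * \<Psi> (real (Suc i) / u)"])
      moreover have "(\<Sum>i<n. u * \<Psi> (real (Suc (Suc i)) / u) - u * \<Psi> (real (Suc i) / u)) \<le> (\<Sum>i<n. f i)"
        by (intro sum_mono le2)
      moreover have "(\<Sum>i<n. f i) \<le> (\<Sum>i. f i)" by (intro sum_le_suminf tele) (use f0 in auto)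
      ultimately show ?thesis by simp
    qed
    have "\<Psi> x \<le> ((\<Sum>i. f i) + 1) / u" if "x \<ge> 0" for x
    proof -
      obtain n where n: "x * u \<le> real n" using real_arch_simple by blast
      have "\<Psi> x \<le> \<Psi> (real (Suc n) / u)" using that n u by (intro mono) (auto simp: field_simps)
      then have "u * \<Psi> x \<le> u * \<Psi> (real (Suc n) / u)" using u by (intro mult_left_mono) auto
      then have "u * \<Psi> x \<le> (\<Sum>i. f i) + 1" using low[of n] by linarith
      then show ?thesis using u by (simp add: field_simps)
    qed
    then have "K \<le> ((\<Sum>i. f i) + 1) / u" unfolding K_def by (intro cSUP_least) auto
    then have "K * u - 1 \<le> (\<Sum>i. f i)" using u by (simp add: field_simps)
    then show ?thesis using up tele(1) unfolding f_def u_def by (auto simp: abs_le_iff)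
  qed
  then show ?thesis using that Kpos by blast
qed

text \<open>\<open>K\<close> is chosen before \<eta>, so the conclusion is an expansion of the mean
  with error \<open>o(n powr (\<theta>/2))\<close>. That \<open>B\<close> serves every
  \<open>n\<close>, and not only large ones, matters later: the expansion is applied at times
  \<open>nat \<lfloor>real n * t\<rfloor>\<close>, which may be small.\<close>

lemma expected_distinct_asymptotics:
  fixes p :: "nat \<Rightarrow> real" and \<theta> c :: real
  assumes p: "\<And>i. 0 \<le> p i" "\<And>i. p i \<le> 1" and sp: "summable (\<lambda>i. p (Suc i))"
    and \<theta>: "0 < \<theta>" "\<theta> < 1" and c: "c > 0"
    and asym: "(\<lambda>i. p i / (c * real i powr (-1/\<theta>)) - 1) \<in> o(\<lambda>i. real i powr (-1/2))"
  obtains K :: real where "K > 0"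
    "\<And>\<eta>. \<eta> > 0 \<Longrightarrow> \<exists>B. \<forall>n. \<bar>(\<Sum>i. 1 - (1 - p (Suc i)) ^ n) - K * real n powr \<theta>\<bar> \<le> \<eta> * real n powr (\<theta>/2) + B"
proof -
  obtain K where K: "K > 0"
    "\<And>a. a > 0 \<Longrightarrow> summable (\<lambda>i. 1 - exp (- (a * real (Suc i) powr (-1/\<theta>))))"
    "\<And>a. a > 0 \<Longrightarrow> \<bar>(\<Sum>i. 1 - exp (- (a * real (Suc i) powr (-1/\<theta>)))) - K * a powr \<theta>\<bar> \<le> 1"
    by (rule poisson_sum_power_law[OF \<theta>]) (rule that; assumption)
  show ?thesis
  proof (rule that[of "K * c powr \<theta>"])
    fix \<eta> :: real assume "\<eta> > 0"
    from poisson_sum_perturbation[OF p(1) \<theta> c asym \<open>\<eta> > 0\<close>]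
    obtain B where B: "\<And>n. summable (\<lambda>i. \<bar>exp (- (real n * p (Suc i))) - exp (- (real n * (c * real (Suc i) powr (-1/\<theta>))))\<bar>)"
      and B': "\<And>n. (\<Sum>i. \<bar>exp (- (real n * p (Suc i))) - exp (- (real n * (c * real (Suc i) powr (-1/\<theta>))))\<bar>)
       \<le> \<eta> * real n powr (\<theta>/2) + B" by blast
    define S where "S = (\<Sum>i. p (Suc i))"
    have S: "S \<ge> 0" unfolding S_def by (intro suminf_nonneg sp p)
    have B0: "B \<ge> 0" using B'[of 0] by simp
    have "\<bar>(\<Sum>i. 1 - (1 - p (Suc i)) ^ n) - K * c powr \<theta> * real n powr \<theta>\<bar> \<le> \<eta> * real n powr (\<theta>/2) + (B + 3 * S + 1)" for n
    proof (cases "n = 0")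
      case True
      then show ?thesis using B0 S by simp
    next
      case False
      define a where "a = real n * c"
      have a: "a > 0" using False c by (simp add: a_def)
      define f1 where "f1 = (\<lambda>i. 1 - (1 - p (Suc i)) ^ n)"
      define f2 where "f2 = (\<lambda>i. exp (- (real n * p (Suc i))) - (1 - p (Suc i)) ^ n)"
      define f3 where "f3 = (\<lambda>i. exp (- (real n * p (Suc i))) - exp (- (real n * (c * real (Suc i) powr (-1/\<theta>)))))"
      define f4 where "f4 = (\<lambda>i. 1 - exp (- (a * real (Suc i) powr (-1/\<theta>))))"
      \<comment> \<open>\<open>f2\<close> is the Poissonization error, \<open>f3\<close> the effect
        of replacing \<open>p\<close> by the power law, \<open>f4\<close> the Poissonized term of
        the exact power law.\<close>
      have eq: "f1 = (\<lambda>i. f2 i - f3 i + f4 i)"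
        by (auto simp: f1_def f2_def f3_def f4_def a_def mult.assoc)
      have f2: "\<bar>f2 i\<bar> \<le> 3 * p (Suc i)" for i unfolding f2_def by (intro power_one_minus_vs_exp p)
      have s2a: "summable (\<lambda>i. \<bar>f2 i\<bar>)"
        by (rule summable_comparison_test[OF _ summable_mult[OF sp, of 3]]) (use f2 in auto)
      have s2: "summable f2" using s2a by (rule summable_rabs_cancel)
      have s3: "summable f3" using B[of n] unfolding f3_def by (rule summable_rabs_cancel)
      have s4: "summable f4" using K(2)[OF a] by (simp add: f4_def)
      have "(\<Sum>i. f1 i) = (\<Sum>i. f2 i) - (\<Sum>i. f3 i) + (\<Sum>i. f4 i)"
        unfolding eq using s2 s3 s4 by (simp add: suminf_add suminf_diff summable_diff)
      moreover have "\<bar>\<Sum>i. f2 i\<bar> \<le> 3 * S"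
      proof -
        have "\<bar>\<Sum>i. f2 i\<bar> \<le> (\<Sum>i. \<bar>f2 i\<bar>)" by (rule summable_rabs[OF s2a])
        also have "\<dots> \<le> (\<Sum>i. 3 * p (Suc i))" by (intro suminf_le f2 s2a summable_mult sp)
        also have "\<dots> = 3 * S" unfolding S_def by (intro suminf_mult sp)
        finally show ?thesis .
      qed
      moreover have "\<bar>\<Sum>i. f3 i\<bar> \<le> \<eta> * real n powr (\<theta>/2) + B"
        using summable_rabs[of f3] B[of n] B'[of n] unfolding f3_def by linarith
      moreover have "\<bar>(\<Sum>i. f4 i) - K * a powr \<theta>\<bar> \<le> 1" using K(3)[OF a] by (simp add: f4_def)
      moreover have "K * a powr \<theta> = K * c powr \<theta> * real n powr \<theta>" using c by (simp add: a_def powr_mult)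
      ultimately show ?thesis unfolding f1_def by linarith
    qed
    then show "\<exists>B. \<forall>n. \<bar>(\<Sum>i. 1 - (1 - p (Suc i)) ^ n) - K * c powr \<theta> * real n powr \<theta>\<bar> \<le> \<eta> * real n powr (\<theta>/2) + B"
      by blast
  qed (use K c in simp)
qed

section \<open>Mean and variance of the number of distinct words\<close>

lemma nwords_le: "nwords X j \<omega> \<le> j"
  unfolding nwords_def using card_image_le[of "{..<j}" "\<lambda>k. X k \<omega>"] by simp

lemma nwords_mono: "j \<le> k \<Longrightarrow> nwords X j \<omega> \<le> nwords X k \<omega>"
  unfolding nwords_def by (intro card_mono) auto

text \<open>The series in \<open>ennreal\<close> lets first and second moments be computed term by
  term under the integral, without summability conditions.\<close>

lemma nwords_eq_suminf:
  "ennreal (real (nwords X j \<omega>)) = (\<Sum>i. indicator ((\<lambda>k. X k \<omega>) ` {..<j}) i)"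
proof -
  let ?S = "(\<lambda>k. X k \<omega>) ` {..<j}"
  have "(\<Sum>i. indicator ?S i :: ennreal) = (\<Sum>i\<in>?S. indicator ?S i)"
    by (intro suminf_finite) auto
  also have "\<dots> = (\<Sum>i\<in>?S. 1)" by (intro sum.cong) auto
  also have "\<dots> = ennreal (real (nwords X j \<omega>))"
    by (simp add: nwords_def ennreal_of_nat_eq_real_of_nat)
  finally show ?thesis by simp
qed

locale iid_words = prob_space M for M :: "'a measure" +
  fixes X :: "nat \<Rightarrow> 'a \<Rightarrow> nat" and p :: "nat \<Rightarrow> real"
  assumes X_meas: "\<And>k. X k \<in> measurable M (count_space UNIV)"
    and X_indep: "indep_vars (\<lambda>_. count_space UNIV) X UNIV"
    and X_distr: "\<And>k i. prob {\<omega> \<in> space M. X k \<omega> = i} = p i"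
    and p_sum: "(p has_sum 1) {1..}"
begin

declare X_meas [measurable]

definition seen :: "nat \<Rightarrow> nat \<Rightarrow> 'a set" where
  "seen j i = {\<omega> \<in> space M. \<exists>k<j. X k \<omega> = i}"

definition seen_prob :: "nat \<Rightarrow> nat \<Rightarrow> real" where
  "seen_prob j i = 1 - (1 - p i) ^ j"

lemma seen_meas [measurable]: "seen j i \<in> events"
  unfolding seen_def by measurable

lemma p_bounds: "0 \<le> p i" "p i \<le> 1"
  unfolding X_distr[of 0 i, symmetric] by auto

lemma prob_in_finite: "finite F \<Longrightarrow> prob {\<omega> \<in> space M. X k \<omega> \<in> F} = sum p F"
proof -
  assume F: "finite F"
  have "prob (\<Union>i\<in>F. {\<omega> \<in> space M. X k \<omega> = i}) = (\<Sum>i\<in>F. prob {\<omega> \<in> space M. X k \<omega> = i})"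
    using F by (intro finite_measure_finite_Union) (auto simp: disjoint_family_on_def)
  moreover have "(\<Union>i\<in>F. {\<omega> \<in> space M. X k \<omega> = i}) = {\<omega> \<in> space M. X k \<omega> \<in> F}" by auto
  ultimately show ?thesis by (simp add: X_distr)
qed

lemma sum_p_le: "finite F \<Longrightarrow> sum p F \<le> 1"
  using prob_in_finite[of F 0] prob_le_1 by metis

text \<open>The dictionary starts at 1, whereas a draw is an arbitrary natural number. The masses on
  \<open>{1..}\<close> already exhaust the total mass 1, so 0 is drawn with probability 0 and may be
  included in series over all of \<open>nat\<close>.\<close>

lemma p_0: "p 0 = 0"
proof -
  have "1 \<le> 1 - p 0"
  proof (rule has_sum_le_finite_sums[OF p_sum])
    fix F :: "nat set" assume F: "finite F" "F \<subseteq> {1..}"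
    then have "0 \<notin> F" by auto
    then show "sum p F \<le> 1 - p 0" using sum_p_le[of "insert 0 F"] F by simp
  qed
  then show ?thesis using p_bounds[of 0] by simp
qed

lemma summable_p: "summable (\<lambda>i. p (Suc i))"
proof (rule summableI_nonneg_bounded)
  fix n
  have "(\<Sum>i<n. p (Suc i)) = sum p (Suc ` {..<n})" by (simp add: sum.reindex)
  also have "\<dots> \<le> 1" by (intro sum_p_le) auto
  finally show "(\<Sum>i<n. p (Suc i)) \<le> 1" .
qed (use p_bounds in auto)

lemma prob_avoid:
  assumes F: "finite F"
  shows "prob {\<omega> \<in> space M. \<forall>k<j. X k \<omega> \<notin> F} = (1 - sum p F) ^ j"
\<comment> \<open>For \<open>j = 0\<close> the intersection over the empty index set would be
  \<open>UNIV\<close> and not \<open>space M\<close>.\<close>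
proof (cases "j = 0")
  case True then show ?thesis using prob_space by simp
next
  case False
  have *: "prob (X k -` (- F) \<inter> space M) = 1 - sum p F" for k
  proof -
    have "X k -` (- F) \<inter> space M = space M - {\<omega> \<in> space M. X k \<omega> \<in> F}" by auto
    then show ?thesis using prob_in_finite[OF F] by (simp add: prob_compl)
  qed
  have "{\<omega> \<in> space M. \<forall>k<j. X k \<omega> \<notin> F} = (\<Inter>k\<in>{..<j}. X k -` (- F) \<inter> space M)"
    using False by auto
  also have "prob \<dots> = (\<Prod>k<j. prob (X k -` (- F) \<inter> space M))"
    using False by (intro indep_varsD[OF X_indep]) auto
  finally show ?thesis by (simp add: *)
qed

lemma prob_seen: "prob (seen j i) = seen_prob j i"
proof -
  have "seen j i = space M - {\<omega> \<in> space M. \<forall>k<j. X k \<omega> \<notin> {i}}" by (auto simp: seen_def)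
  then show ?thesis using prob_avoid[of "{i}" j] by (simp add: prob_compl seen_prob_def)
qed

lemma seen_prob_nonneg: "0 \<le> seen_prob j i"
  by (simp flip: prob_seen)

text \<open>Negative correlation is easiest to see for missed words: a draw avoids both with
  probability \<open>1 - p i - p l\<close>, at most \<open>(1 - p i) * (1 - p l)\<close>.
  Inclusion-exclusion transfers the inequality to the complements.\<close>

lemma prob_seen_both:
  assumes "i \<noteq> l"
  shows "prob (seen j i \<inter> seen j l) \<le> seen_prob j i * seen_prob j l"
proof -
  have "1 - prob (seen j i \<union> seen j l) = prob (space M - (seen j i \<union> seen j l))"
    by (simp add: prob_compl)
  also have "space M - (seen j i \<union> seen j l) = {\<omega> \<in> space M. \<forall>k<j. X k \<omega> \<notin> {i, l}}"
    by (auto simp: seen_def)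
  also have "prob \<dots> = (1 - p i - p l) ^ j" using prob_avoid[of "{i,l}" j] assms by (simp add: algebra_simps)
  also have "\<dots> \<le> ((1 - p i) * (1 - p l)) ^ j"
    using sum_p_le[of "{i,l}"] assms p_bounds by (intro power_mono) (auto simp: algebra_simps)
  finally have "1 - prob (seen j i \<union> seen j l) \<le> (1 - seen_prob j i) * (1 - seen_prob j l)"
    by (simp add: seen_prob_def power_mult_distrib)
  moreover have "prob (seen j i \<union> seen j l) = seen_prob j i + seen_prob j l - prob (seen j i \<inter> seen j l)"
    using finite_measure_Union'[of "seen j i" "seen j l"] finite_measure_Diff'[of "seen j l" "seen j i"]
    by (simp add: prob_seen Int_commute)
  ultimately show ?thesis by (simp add: algebra_simps)
qed

lemma nwords_seen:
  assumes "\<omega> \<in> space M"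
  shows "ennreal (real (nwords X j \<omega>)) = (\<Sum>i. indicator (seen j i) \<omega>)"
  unfolding nwords_eq_suminf
  by (intro arg_cong[where f=suminf] ext) (use assms in \<open>auto simp: seen_def indicator_def\<close>)

lemma nwords_meas [measurable]: "(\<lambda>\<omega>. real (nwords X j \<omega>)) \<in> borel_measurable M"
proof -
  have "(\<lambda>\<omega>. enn2real (\<Sum>i. indicator (seen j i) \<omega>)) \<in> borel_measurable M" by measurable
  then show ?thesis
    by (rule measurable_cong[THEN iffD1, rotated]) (simp flip: nwords_seen)
qed

lemma integrable_nwords [simp]: "integrable M (\<lambda>\<omega>. real (nwords X j \<omega>))"
  by (rule integrable_const_bound[of _ "real j"]) (use nwords_le[of X j] in auto)

lemma integrable_nwords_sq [simp]: "integrable M (\<lambda>\<omega>. (real (nwords X j \<omega>))\<^sup>2)"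
  by (rule integrable_const_bound[of _ "(real j)\<^sup>2"]) (use nwords_le[of X j] in auto)

lemma ennreal_expectation_nwords:
  "ennreal (expectation (\<lambda>\<omega>. real (nwords X j \<omega>))) = (\<Sum>i. ennreal (seen_prob j i))"
proof -
  have "ennreal (expectation (\<lambda>\<omega>. real (nwords X j \<omega>))) = (\<integral>\<^sup>+\<omega>. ennreal (real (nwords X j \<omega>)) \<partial>M)"
    by (intro nn_integral_eq_integral[symmetric]) auto
  also have "\<dots> = (\<integral>\<^sup>+\<omega>. (\<Sum>i. indicator (seen j i) \<omega>) \<partial>M)"
    by (intro nn_integral_cong nwords_seen)
  also have "\<dots> = (\<Sum>i. ennreal (seen_prob j i))"
    by (subst nn_integral_suminf) (auto simp: emeasure_eq_measure prob_seen)
  finally show ?thesis .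
qed

lemma expectation_nwords:
  "expectation (\<lambda>\<omega>. real (nwords X j \<omega>)) = (\<Sum>i. 1 - (1 - p (Suc i)) ^ j)"
proof -
  have le: "seen_prob j i \<le> real j * p i" for i
    using Bernoulli_inequality[of "- p i" j] p_bounds by (simp add: seen_prob_def)
  have s': "summable (\<lambda>i. seen_prob j (Suc i))"
    by (rule summable_comparison_test[OF _ summable_mult[OF summable_p, of "real j"]])
      (use le seen_prob_nonneg in auto)
  then have s: "summable (seen_prob j)" using summable_Suc_iff by blast
  have "ennreal (expectation (\<lambda>\<omega>. real (nwords X j \<omega>))) = ennreal (\<Sum>i. seen_prob j i)"
    unfolding ennreal_expectation_nwords by (intro suminf_ennreal2 seen_prob_nonneg s)
  then have "expectation (\<lambda>\<omega>. real (nwords X j \<omega>)) = (\<Sum>i. seen_prob j i)"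
    by (subst (asm) ennreal_inj) (auto intro!: suminf_nonneg s seen_prob_nonneg integral_nonneg_AE)
  also have "\<dots> = (\<Sum>i. seen_prob j (Suc i)) + seen_prob j 0"
    using suminf_split_head[OF s] by simp
  finally show ?thesis by (simp add: seen_prob_def p_0)
qed

text \<open>The squared count is a double series of joint indicators. Its diagonal has expectation
  \<open>m\<close>, and by negative correlation the rest contributes at most the square of
  \<open>m\<close>, which is exactly what the variance subtracts.\<close>

lemma variance_nwords_le:
  "variance (\<lambda>\<omega>. real (nwords X j \<omega>)) \<le> expectation (\<lambda>\<omega>. real (nwords X j \<omega>))"
proof -
  define R where "R = (\<lambda>\<omega>. real (nwords X j \<omega>))"
  define m where "m = expectation R"
  have m: "m \<ge> 0" unfolding m_def R_def by (intro integral_nonneg_AE) auto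
  have mE: "ennreal m = (\<Sum>i. ennreal (seen_prob j i))"
    unfolding m_def R_def by (rule ennreal_expectation_nwords)
  \<comment> \<open>On the diagonal the product is added on top of the exact value. This surplus
    makes the second part a full product, so that its double series factors into
    \<open>m * m\<close>.\<close>
  have pair: "emeasure M (seen j i \<inter> seen j l) \<le>
      (if i = l then ennreal (seen_prob j l) else 0) + ennreal (seen_prob j i) * ennreal (seen_prob j l)" for i l
    using prob_seen_both[of i l j] 
    by (auto simp: emeasure_eq_measure prob_seen seen_prob_nonneg simp flip: ennreal_mult)
  have diag: "(\<Sum>i. if i = l then ennreal (seen_prob j l) else 0) = ennreal (seen_prob j l)" for l
    by (subst suminf_finite[of "{l}"]) auto
  have "ennreal (expectation (\<lambda>\<omega>. (R \<omega>)\<^sup>2)) = (\<integral>\<^sup>+\<omega>. ennreal ((R \<omega>)\<^sup>2) \<partial>M)"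
    unfolding R_def by (intro nn_integral_eq_integral[symmetric]) auto
  also have "\<dots> = (\<integral>\<^sup>+\<omega>. (\<Sum>l. \<Sum>i. indicator (seen j i \<inter> seen j l) \<omega>) \<partial>M)"
  proof (intro nn_integral_cong)
    fix \<omega> assume \<omega>: "\<omega> \<in> space M"
    have "ennreal ((R \<omega>)\<^sup>2) = ennreal (R \<omega>) * (\<Sum>l. indicator (seen j l) \<omega>)"
      using nwords_seen[OF \<omega>, of j] by (simp add: R_def power2_eq_square ennreal_mult)
    also have "\<dots> = (\<Sum>l. ennreal (R \<omega>) * indicator (seen j l) \<omega>)" by simp
    also have "\<dots> = (\<Sum>l. \<Sum>i. indicator (seen j i) \<omega> * indicator (seen j l) \<omega>)"
      using nwords_seen[OF \<omega>, of j] by (simp add: R_def)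
    finally show "ennreal ((R \<omega>)\<^sup>2) = (\<Sum>l. \<Sum>i. indicator (seen j i \<inter> seen j l) \<omega>)"
      by (simp add: indicator_inter_arith)
  qed
  also have "\<dots> = (\<Sum>l. \<Sum>i. emeasure M (seen j i \<inter> seen j l))"
    by (simp add: nn_integral_suminf)
  also have "\<dots> \<le> (\<Sum>l. \<Sum>i. (if i = l then ennreal (seen_prob j l) else 0) + ennreal (seen_prob j i) * ennreal (seen_prob j l))"
    by (intro suminf_le pair) auto
  also have "\<dots> = (\<Sum>l. ennreal (seen_prob j l) + ennreal m * ennreal (seen_prob j l))"
    by (simp add: mE diag flip: suminf_add)
  also have "\<dots> = ennreal m + ennreal m * ennreal m"
    by (simp add: mE flip: suminf_add)
  also have "\<dots> = ennreal (m + m * m)" using m by (simp flip: ennreal_mult ennreal_plus)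
  finally have "expectation (\<lambda>\<omega>. (R \<omega>)\<^sup>2) \<le> m + m * m" using m by (subst (asm) ennreal_le_iff) auto
  moreover have "variance R = expectation (\<lambda>\<omega>. (R \<omega>)\<^sup>2) - m\<^sup>2"
    unfolding m_def R_def by (intro variance_eq) auto
  ultimately show ?thesis unfolding m_def R_def by (simp add: power2_eq_square)
qed

end

section \<open>The Stieltjes integral of an admissible weight\<close>

lemma consecutive_containing:
  assumes D: "partition01 D" and t: "t \<in> {0<..<1}" "t \<notin> D"
  obtains a b where "consecutive D a b" "t \<in> {a<..<b}"
proof -
  define a where "a = Max {d\<in>D. d < t}"
  define b where "b = Min {d\<in>D. t < d}"
  have fin: "finite D" "0 \<in> D" "1 \<in> D" using D by (auto simp: partition01_def)
  have "a \<in> {d\<in>D. d < t}" unfolding a_def using fin t by (intro Max_in) auto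
  moreover have "b \<in> {d\<in>D. t < d}" unfolding b_def using fin t by (intro Min_in) auto
  moreover have "{a<..<b} \<inter> D = {}"
  proof (rule ccontr)
    assume "{a<..<b} \<inter> D \<noteq> {}"
    then obtain d where d: "d \<in> D" "a < d" "d < b" by auto
    have "d \<le> a" if "d < t" unfolding a_def using that d fin by (intro Max_ge) auto
    moreover have "b \<le> d" if "t < d" unfolding b_def using that d fin by (intro Min_le) auto
    ultimately show False using d t by (cases "d < t"; cases "d = t") auto
  qed
  ultimately have "consecutive D a b" "t \<in> {a<..<b}" by (auto simp: consecutive_def)
  then show ?thesis by (rule that)
qed

lemma consecutive_predecessor:
  assumes D: "partition01 D" and x: "x \<in> D" "0 < x"
  obtains y where "consecutive D y x"
proof -
  define a where "a = Max {d\<in>D. d < x}"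
  have fin: "finite D" "0 \<in> D" using D by (auto simp: partition01_def)
  have a: "a \<in> {d\<in>D. d < x}" unfolding a_def using fin x by (intro Max_in) auto
  have "d \<le> a" if "d < x" "d \<in> D" for d unfolding a_def using that fin by (intro Max_ge) auto
  then have "consecutive D a x" using a x by (fastforce simp: consecutive_def)
  then show ?thesis by (rule that)
qed

lemma consecutive_coarsen:
  assumes D: "partition01 D" "D \<subseteq> E" "E \<subseteq> {0..1}" and ab: "consecutive E a b"
  obtains a' b' where "consecutive D a' b'" "a' \<le> a" "b \<le> b'"
proof -
  define a' where "a' = Max {d\<in>D. d \<le> a}"
  define b' where "b' = Min {d\<in>D. b \<le> d}"
  have fin: "finite D" "0 \<in> D" "1 \<in> D" using D by (auto simp: partition01_def)
  have E: "0 \<le> a" "a < b" "b \<le> 1" "{a<..<b} \<inter> D = {}"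
    using ab D by (auto simp: consecutive_def)
  have a': "a' \<in> {d\<in>D. d \<le> a}" unfolding a'_def using fin E by (intro Max_in) auto
  have b': "b' \<in> {d\<in>D. b \<le> d}" unfolding b'_def using fin E by (intro Min_in) auto
  have "{a'<..<b'} \<inter> D = {}"
  proof (rule ccontr)
    assume "{a'<..<b'} \<inter> D \<noteq> {}"
    then obtain d where d: "d \<in> D" "a' < d" "d < b'" by auto
    have "d \<le> a'" if "d \<le> a" unfolding a'_def using that d fin by (intro Max_ge) auto
    moreover have "b' \<le> d" if "b \<le> d" unfolding b'_def using that d fin by (intro Min_le) auto
    ultimately show False using d E(4) by (metis IntI empty_iff greaterThanLessThan_iff not_le)
  qed
  then have "consecutive D a' b'" using a' b' E by (auto simp: consecutive_def)
  then show ?thesis using a' b' that by auto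
qed

text \<open>The step part and the smooth part come with partitions of their own. The union of the
  two serves both, since each of its pieces lies inside a piece of either.\<close>

lemma admissible_weight_pieces:
  assumes "admissible_weight A"
  obtains D S G where "partition01 D" "continuous_on {0..1} G"
    "\<And>t. t \<in> {0..1} \<Longrightarrow> A t = S t + G t"
    "\<And>a b. consecutive D a b \<Longrightarrow> \<exists>v. \<forall>t\<in>{a<..<b}. S t = v"
    "\<And>a b. consecutive D a b \<Longrightarrow> \<exists>G'. continuous_on {a..b} G' \<and>
        (\<forall>t\<in>{a..b}. (G has_real_derivative G' t) (at t within {a..b}))"
proof -
  obtain S G where "step_fun01 S" "piecewise_C1_01 G"
    and ASG: "\<And>t. t \<in> {0..1} \<Longrightarrow> A t = S t + G t"
    using assms unfolding admissible_weight_def by blast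
  then obtain D1 D2 where D1: "partition01 D1"
      "\<And>a b. consecutive D1 a b \<Longrightarrow> \<exists>v. \<forall>t\<in>{a<..<b}. S t = v"
    and D2: "partition01 D2" "\<And>a b. consecutive D2 a b \<Longrightarrow> \<exists>G'. continuous_on {a..b} G' \<and>
        (\<forall>t\<in>{a..b}. (G has_real_derivative G' t) (at t within {a..b}))"
    and G: "continuous_on {0..1} G"
    unfolding step_fun01_def piecewise_C1_01_def by blast
  have D: "partition01 (D1 \<union> D2)" using D1(1) D2(1) by (auto simp: partition01_def)
  then have D': "D1 \<union> D2 \<subseteq> {0..1}" by (auto simp: partition01_def)
  show ?thesis
  proof (rule that[OF D G ASG])
    fix a b assume "consecutive (D1 \<union> D2) a b"
    then obtain a' b' where "consecutive D1 a' b'" "a' \<le> a" "b \<le> b'"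
      using consecutive_coarsen[OF D1(1) _ D'] by blast
    then show "\<exists>v. \<forall>t\<in>{a<..<b}. S t = v" using D1(2)[of a' b'] by (meson greaterThanLessThan_iff le_less_trans less_le_trans)
  next
    fix a b assume "consecutive (D1 \<union> D2) a b"
    then obtain a' b' where ab: "consecutive D2 a' b'" "a' \<le> a" "b \<le> b'"
      using consecutive_coarsen[OF D2(1) _ D'] by blast
    then obtain G' where G': "continuous_on {a'..b'} G'"
        "\<forall>t\<in>{a'..b'}. (G has_real_derivative G' t) (at t within {a'..b'})"
      using D2(2) by blast
    have sub: "{a..b} \<subseteq> {a'..b'}" using ab by auto
    show "\<exists>G'. continuous_on {a..b} G' \<and>
        (\<forall>t\<in>{a..b}. (G has_real_derivative G' t) (at t within {a..b}))"
      using G' sub by (intro exI[of _ G']) (meson DERIV_subset continuous_on_subset subsetD)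
  qed
qed

text \<open>Limits and \<open>deriv\<close> are traded for finitely many atoms and a bounded
  density, all on [\<delta>, 1], so that linearity in \<open>f\<close> becomes accessible. The total
  mass is \<open>A 1 - A 0\<close>: the jumps telescope to \<open>G 0 - G 1\<close> because the
  continuous part \<open>G\<close> has none, and the density integrates to
  \<open>G 1 - G 0\<close>.\<close>

lemma LS_integral_representation:
  assumes A: "admissible_weight A" "A 0 = 0" "A 1 = 0"
    and A0: "(A \<longlongrightarrow> 0) (at_right 0)"
    and \<delta>: "0 < \<delta>" "\<delta> < 1" and A\<delta>: "\<forall>t\<in>{0..\<delta>}. A t = 0"
  obtains J w g and B :: real where "finite J" "J \<subseteq> {\<delta>..1}" "g \<in> borel_measurable borel"
    "\<And>t. \<bar>g t\<bar> \<le> B * indicator {\<delta>..1} t"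
    "\<And>f. LS_integral A f = (\<Sum>t\<in>J. f t * w t) + (LINT t|lborel. f t * g t)"
    "(\<Sum>t\<in>J. w t) + (LINT t|lborel. g t) = 0"
proof -
  obtain D S G where D: "partition01 D" and G: "continuous_on {0..1} G"
    and ASG: "\<And>t. t \<in> {0..1} \<Longrightarrow> A t = S t + G t"
    and S: "\<And>a b. consecutive D a b \<Longrightarrow> \<exists>v. \<forall>t\<in>{a<..<b}. S t = v"
    and G': "\<And>a b. consecutive D a b \<Longrightarrow> \<exists>G'. continuous_on {a..b} G' \<and>
        (\<forall>t\<in>{a..b}. (G has_real_derivative G' t) (at t within {a..b}))"
    by (rule admissible_weight_pieces[OF A(1)]) (rule that; assumption)
  have fin: "finite D" "0 \<in> D" "1 \<in> D" "D \<subseteq> {0..1}" using D by (auto simp: partition01_def)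
  define U where "U = {0<..<1} - D"
  have openU: "open U" unfolding U_def by (intro open_Diff finite_imp_closed fin) auto
  \<comment> \<open>At partition points \<open>deriv A\<close> may be an unspecified value, so these
    are masked; being finitely many, they form a null set.\<close>
  define g where "g = (\<lambda>t. indicator U t * deriv A t)"

  have sub01: "{a..b} \<subseteq> {0..1}" "a < b" if "consecutive D a b" for a b
    using that fin unfolding consecutive_def by auto
  have piece: "(A has_real_derivative G' t) (at t) \<and> (G has_real_derivative G' t) (at t)"
    if ab: "consecutive D a b" and t: "t \<in> {a<..<b}"
      and G': "\<forall>t\<in>{a..b}. (G has_real_derivative G' t) (at t within {a..b})" for a b t G'
  proof -
    obtain v where v: "\<forall>t\<in>{a<..<b}. S t = v" using S ab by blast
    have 1: "(G has_real_derivative G' t) (at t)"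
      using G' t at_within_Icc_at[of a t b] by (metis atLeastAtMost_iff greaterThanLessThan_iff less_imp_le)
    have 2: "((\<lambda>t. v + G t) has_real_derivative G' t) (at t)" using 1 by (auto intro!: derivative_eq_intros)
    have "(A has_real_derivative G' t) (at t)"
    proof (rule has_field_derivative_transform_within_open[OF 2])
      show "open {a<..<b}" by simp
      show "v + G x = A x" if "x \<in> {a<..<b}" for x
        using that v ASG sub01[OF ab] by (auto simp: subset_iff)
    qed (use t in auto)
    with 1 show ?thesis by blast
  qed

  have bound: "\<exists>B. \<forall>t\<in>{a<..<b}. \<bar>deriv A t\<bar> \<le> B" if ab: "consecutive D a b" for a b
  proof -
    obtain G' where g: "continuous_on {a..b} G'"
        "\<forall>t\<in>{a..b}. (G has_real_derivative G' t) (at t within {a..b})" using G'[OF ab] by blast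
    have "compact (G' ` {a..b})" using g(1) by (intro compact_continuous_image) auto
    then obtain B where B: "\<forall>t\<in>{a..b}. \<bar>G' t\<bar> \<le> B" 
      using compact_imp_bounded bounded_iff by (metis (no_types, lifting) imageI real_norm_def)
    have "\<forall>t\<in>{a<..<b}. \<bar>deriv A t\<bar> \<le> B"
      using B piece[OF ab _ g(2)] DERIV_imp_deriv by (metis atLeastAtMost_iff greaterThanLessThan_iff less_imp_le)
    then show ?thesis by blast
  qed
  define C where "C = {(a,b). consecutive D a b}"
  have finC: "finite C" 
    by (rule finite_subset[of _ "D \<times> D"]) (use fin in \<open>auto simp: C_def consecutive_def\<close>)
  have "\<forall>ab\<in>C. \<exists>b. \<forall>t\<in>{fst ab<..<snd ab}. \<bar>deriv A t\<bar> \<le> b"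
    using bound by (auto simp: C_def)
  from bchoice[OF this] obtain bd where
    bd: "\<forall>ab\<in>C. \<forall>t\<in>{fst ab<..<snd ab}. \<bar>deriv A t\<bar> \<le> bd ab" by blast
  define B where "B = (\<Sum>ab\<in>C. \<bar>bd ab\<bar>)"
  have gB: "\<bar>g t\<bar> \<le> B" for t
  proof (cases "t \<in> U")
    case True
    then obtain a b where ab: "consecutive D a b" "t \<in> {a<..<b}"
      using True consecutive_containing[OF D, of t] unfolding U_def by auto
    then have "\<bar>deriv A t\<bar> \<le> \<bar>bd (a,b)\<bar>" using bd unfolding C_def by force
    also have "\<dots> \<le> B" unfolding B_def using ab finC 
      by (intro member_le_sum[of _ _ "\<lambda>ab. \<bar>bd ab\<bar>"]) (auto simp: C_def)
    finally show ?thesis using True by (simp add: g_def)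
  next
    case False then show ?thesis by (simp add: g_def B_def sum_nonneg)
  qed
  have derivU: "(A has_real_derivative deriv A t) (at t)" "(G has_real_derivative deriv A t) (at t)"
      "isCont (deriv A) t" if tU: "t \<in> U" for t
  proof -
    obtain a b where ab: "consecutive D a b" "t \<in> {a<..<b}"
      using tU consecutive_containing[OF D, of t] unfolding U_def by auto
    obtain G' where g: "continuous_on {a..b} G'"
        "\<forall>t\<in>{a..b}. (G has_real_derivative G' t) (at t within {a..b})" using G'[OF ab(1)] by blast
    note p = piece[OF ab(1) _ g(2)]
    have e: "deriv A s = G' s" if "s \<in> {a<..<b}" for s using p[OF that] DERIV_imp_deriv by blast
    show "(A has_real_derivative deriv A t) (at t)" "(G has_real_derivative deriv A t) (at t)"
      using p[OF ab(2)] e[OF ab(2)] by auto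
    have "continuous_on {a<..<b} G'" using g(1) by (rule continuous_on_subset) auto
    then have "continuous_on {a<..<b} (deriv A)" using e continuous_on_cong[of "{a<..<b}" "{a<..<b}" "deriv A" G'] by blast
    then show "isCont (deriv A) t" using ab(2) by (simp add: continuous_on_eq_continuous_at)
  qed
  have gmeas: "g \<in> borel_measurable borel"
  proof -
    have "continuous_on U (deriv A)" using derivU(3) by (simp add: continuous_at_imp_continuous_on)
    then have "(\<lambda>x. indicator U x *\<^sub>R deriv A x) \<in> borel_measurable borel"
      using openU by (intro borel_measurable_continuous_on_indicator) auto
    then show ?thesis by (simp add: g_def)
  qed
  have g0: "g t = 0" if "t \<notin> {\<delta>..1}" for t
  proof (cases "t \<in> U")
    case True
    then have t: "t \<in> {0<..<\<delta>}" using that by (auto simp: U_def)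
    have "(A has_real_derivative 0) (at t)"
      by (rule has_field_derivative_transform_within_open[of "\<lambda>_. 0" _ _ "{0<..<\<delta>}"]) (use t A\<delta> in auto)
    then show ?thesis using DERIV_imp_deriv by (auto simp: g_def)
  qed (simp add: g_def)

  have limr: "right_lim A a = v + G a" and liml: "left_lim A b = v + G b"
    if ab: "consecutive D a b" and v: "\<forall>t\<in>{a<..<b}. S t = v" for a b v
  proof -
    have c: "continuous_on {a..b} G" using G sub01[OF ab] continuous_on_subset by blast
    have lt: "a < b" using sub01[OF ab] by blast
    have e: "v + G t = A t" if "t \<in> {a<..<b}" for t using that v ASG sub01[OF ab] by (auto simp: subset_iff)
    have "((\<lambda>t. v + G t) \<longlongrightarrow> v + G a) (at_right a)"
      using continuous_on_Icc_at_rightD[OF c lt] by (intro tendsto_intros)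
    then have "(A \<longlongrightarrow> v + G a) (at_right a)"
      by (rule Lim_transform_eventually) (use e lt in \<open>auto simp: eventually_at_right intro!: exI[of _ b]\<close>)
    moreover have "a \<noteq> 1" using sub01[OF ab] by auto
    ultimately show "right_lim A a = v + G a" by (auto simp: right_lim_def intro!: tendsto_Lim)
    have "((\<lambda>t. v + G t) \<longlongrightarrow> v + G b) (at_left b)"
      using continuous_on_Icc_at_leftD[OF c lt] by (intro tendsto_intros)
    then have "(A \<longlongrightarrow> v + G b) (at_left b)"
      by (rule Lim_transform_eventually) (use e lt in \<open>auto simp: eventually_at_left intro!: exI[of _ a]\<close>)
    moreover have "b \<noteq> 0" using sub01[OF ab] by auto
    ultimately show "left_lim A b = v + G b" by (auto simp: left_lim_def intro!: tendsto_Lim)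
  qed
  have jump0: "jump A t = 0" if "t \<in> {0<..<1}" "isCont A t" for t
  proof -
    have "(A \<longlongrightarrow> A t) (at_right t)" "(A \<longlongrightarrow> A t) (at_left t)"
      using that(2) by (auto simp: isCont_def filterlim_at_split)
    then show ?thesis using that(1) 
      by (auto simp: jump_def right_lim_def left_lim_def tendsto_Lim)
  qed
  define J where "J = {t\<in>{0..1}. jump A t \<noteq> 0}"
  have JD: "J \<subseteq> D"
  proof
    fix t assume t: "t \<in> J"
    show "t \<in> D"
    proof (rule ccontr)
      assume "t \<notin> D"
      then have "t \<in> U" using t fin unfolding J_def U_def by (auto simp: less_le)
      then show False using jump0[of t] derivU(1)[of t] t DERIV_isCont unfolding J_def U_def by auto
    qed
  qed
  \<comment> \<open>A jump at \<delta> itself is possible, which is why the interval is closed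
    there. At 0 the jump vanishes because \<open>A 0\<close> equals the right limit.\<close>
  have J\<delta>: "J \<subseteq> {\<delta>..1}"
  proof
    fix t assume t: "t \<in> J"
    have "jump A 0 = 0"
      using A0 A(2) by (simp add: jump_def right_lim_def left_lim_def tendsto_Lim)
    moreover have "jump A t = 0" if "t \<in> {0<..<\<delta>}"
    proof (rule jump0)
      have "(A has_real_derivative 0) (at t)"
        by (rule has_field_derivative_transform_within_open[of "\<lambda>_. 0" _ _ "{0<..<\<delta>}"]) (use that A\<delta> in auto)
      then show "isCont A t" by (rule DERIV_isCont)
    qed (use that \<delta> in auto)
    ultimately show "t \<in> {\<delta>..1}" using t unfolding J_def
      by (metis (mono_tags, lifting) atLeastAtMost_iff greaterThanLessThan_iff linorder_not_less mem_Collect_eq order_le_less)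
  qed

  \<comment> \<open>On the piece from \<open>y\<close> to \<open>x\<close> the difference
    \<open>A - G\<close> is constant, so \<open>right_lim A y - G y = left_lim A x - G x\<close>.
    The convention \<open>left_lim A 0 = A 0\<close> starts the induction.\<close>
  have tele: "(\<Sum>t\<in>{t\<in>D. t < x}. jump A t) = (left_lim A x - G x) - (A 0 - G 0)" if "x \<in> D" for x
    using that
  proof (induction "card {t\<in>D. t < x}" arbitrary: x rule: less_induct)
    case less
    show ?case
    proof (cases "x = 0")
      case True
      then have e: "{t\<in>D. t < x} = {}" using fin by auto
      show ?thesis unfolding e using True by (simp add: left_lim_def)
    next
      case False
      then have "0 < x" using less.prems fin by (auto simp: less_le)
      then obtain y where yx: "consecutive D y x" using consecutive_predecessor[OF D less.prems] by blast
      have eq: "{t\<in>D. t < x} = insert y {t\<in>D. t < y}" (is "?L = ?R")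
      proof (intro set_eqI iffI)
        fix t assume "t \<in> ?L"
        then show "t \<in> ?R" using yx by (cases t y rule: linorder_cases) (auto simp: consecutive_def)
      qed (use yx in \<open>auto simp: consecutive_def\<close>)
      have y: "y \<in> D" using yx by (simp add: consecutive_def)
      have "card {t\<in>D. t < y} < card {t\<in>D. t < x}" unfolding eq using fin by simp
      then have IH: "(\<Sum>t\<in>{t\<in>D. t < y}. jump A t) = (left_lim A y - G y) - (A 0 - G 0)"
        using less.hyps y by blast
      obtain v where v: "\<forall>t\<in>{y<..<x}. S t = v" using S yx by blast
      show ?thesis unfolding eq using fin IH limr[OF yx v] liml[OF yx v] 
        by (simp add: jump_def)
    qed
  qed
  \<comment> \<open>By the convention \<open>right_lim A 1 = A 1\<close> the jump at 1 turns the
    left limit into \<open>A 1\<close>.\<close>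
  have "(\<Sum>t\<in>D. jump A t) = (\<Sum>t\<in>insert 1 {t\<in>D. t < 1}. jump A t)"
    by (rule sum.cong) (use fin in force)+
  also have "\<dots> = A 1 - G 1 - (A 0 - G 0)"
    using tele[of 1] fin by (simp add: jump_def right_lim_def)
  finally have "(\<Sum>t\<in>D. jump A t) = G 0 - G 1" using A by simp
  moreover have "(\<Sum>t\<in>J. jump A t) = (\<Sum>t\<in>D. jump A t)"
    by (rule sum.mono_neutral_left) (use JD fin in \<open>auto simp: J_def\<close>)
  ultimately have sumJ: "(\<Sum>t\<in>J. jump A t) = G 0 - G 1" by simp

  have gint: "integrable lborel g"
  proof (rule Bochner_Integration.integrable_bound[of _ "\<lambda>t. B * indicator {\<delta>..1} t"])
    show "AE x in lborel. norm (g x) \<le> norm (B * indicator {\<delta>..1} x)"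
      using g0 order_trans[OF gB abs_ge_self] by (intro AE_I2) (auto simp: indicator_def)
    show "integrable lborel (\<lambda>t. B * indicator {\<delta>..1} t)"
      by (intro integrable_mult_right integrable_real_indicator) (use \<delta> in auto)
  qed (use gmeas in auto)
  have "(g has_integral (LINT t|lborel. g t)) UNIV" by (rule has_integral_integral_lborel[OF gint])
  moreover have "(g has_integral (G 1 - G 0)) UNIV"
  proof -
    have "(g has_integral (G 1 - G 0)) {0..1}"
    proof (rule fundamental_theorem_of_calculus_strong[of D])
      fix x assume "x \<in> {0..1} - D"
      then have x: "x \<in> U" using fin by (auto simp: U_def less_le)
      then show "(G has_vector_derivative g x) (at x)"
        using derivU(2)[OF x] by (simp add: g_def has_real_derivative_iff_has_vector_derivative)
    qed (use fin G in auto)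
    then show ?thesis
      by (rule has_integral_on_superset) (use g0 \<delta> in auto)
  qed
  ultimately have "(LINT t|lborel. g t) = G 1 - G 0" by (rule has_integral_unique)
  then have zero: "(\<Sum>t\<in>J. jump A t) + (LINT t|lborel. g t) = 0" using sumJ by simp

  have rep: "LS_integral A f = (\<Sum>t\<in>J. f t * jump A t) + (LINT t|lborel. f t * g t)" for f
  proof -
    have "(LINT t:{0..1}|lborel. f t * deriv A t) = (LINT t|lborel. f t * g t)"
      unfolding set_lebesgue_integral_def
      by (rule integral_discrete_difference[of D]) 
        (use fin in \<open>auto simp: countable_finite g_def U_def indicator_def less_le\<close>)
    then show ?thesis by (simp add: LS_integral_def J_def)
  qed
  show ?thesis
  proof (rule that[of J g B "jump A", OF _ J\<delta> gmeas _ rep zero])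
    show "finite J" using JD fin finite_subset by blast
    show "\<bar>g t\<bar> \<le> B * indicator {\<delta>..1} t" for t using gB[of t] g0[of t] by (cases "t \<in> {\<delta>..1}") auto
  qed
qed

section \<open>Linearization of the logarithm\<close>

text \<open>The fractions \<open>x / y\<close> and \<open>1 / y\<close> add up to 1, and raising a
  number of [0, 1] to the power \<theta> does not decrease it. This bounds the cost of rounding a
  time down to an integer.\<close>

lemma powr_plus_one_le:
  fixes x \<theta> :: real
  assumes "0 \<le> x" "0 < \<theta>" "\<theta> \<le> 1"
  shows "(x + 1) powr \<theta> \<le> x powr \<theta> + 1"
proof -
  define y where "y = x + 1"
  have y: "y > 0" using assms by (simp add: y_def)
  have "x / y \<le> (x / y) powr \<theta>" if "x > 0"
    using powr_mono'[of \<theta> 1 "x / y"] assms y that by (simp add: y_def)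
  moreover have "1 / y \<le> (1 / y) powr \<theta>"
    using powr_mono'[of \<theta> 1 "1 / y"] assms y by (simp add: y_def)
  moreover have "x / y + 1 / y = 1" using y by (simp add: y_def flip: add_divide_distrib)
  ultimately have "1 \<le> (x / y) powr \<theta> + (1 / y) powr \<theta>" using assms by (cases "x = 0") auto
  also have "\<dots> = (x powr \<theta> + 1) / y powr \<theta>" using assms y by (simp add: powr_divide add_divide_distrib)
  finally show ?thesis using y by (simp add: y_def field_simps)
qed

text \<open>Both quantities compared are \<open>K * (real n * t) powr \<theta>\<close> up to an
  error small against \<open>n powr (\<theta>/2)\<close>, hence against the square root of
  \<open>m n\<close>. Uniformity down to \<open>t = 0\<close> holds because the error allowed at a
  time \<open>j\<close> grows with \<open>j\<close>.\<close>

lemma regular_mean_uniform_bias: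
  fixes m :: "nat \<Rightarrow> real" and \<theta> K :: real
  assumes \<theta>: "0 < \<theta>" "\<theta> < 1" and K: "K > 0" and m0: "\<And>n. 0 \<le> m n"
    and asym: "\<And>\<eta>. \<eta> > 0 \<Longrightarrow> \<exists>B. \<forall>n. \<bar>m n - K * real n powr \<theta>\<bar> \<le> \<eta> * real n powr (\<theta>/2) + B"
  obtains b :: "nat \<Rightarrow> real" where "b \<longlonglongrightarrow> 0"
    "\<forall>\<^sub>F n in sequentially. \<forall>t\<in>{0..1}. \<bar>m (nat \<lfloor>real n * t\<rfloor>) - t powr \<theta> * m n\<bar> \<le> b n * sqrt (m n)"
    "filterlim m at_top sequentially"
proof -
  have half: "(real n powr (\<theta>/2))\<^sup>2 = real n powr \<theta>" for n
    by (simp add: power2_eq_square flip: powr_add)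
  obtain B0 where B0: "\<And>n. \<bar>m n - K * real n powr \<theta>\<bar> \<le> K/2 * real n powr (\<theta>/2) + B0"
    using asym[of "K/2"] K by auto
  have pw: "filterlim (\<lambda>n. real n powr \<theta>) at_top sequentially"
    unfolding filterlim_at_top
  proof
    fix Z :: real
    have "\<forall>\<^sub>F n in sequentially. (max Z 1) powr (1/\<theta>) \<le> real n"
      using filterlim_real_sequentially by (simp add: filterlim_at_top)
    then show "\<forall>\<^sub>F n in sequentially. Z \<le> real n powr \<theta>"
    proof eventually_elim
      case (elim n)
      then have "((max Z 1) powr (1/\<theta>)) powr \<theta> \<le> real n powr \<theta>" using \<theta> by (intro powr_mono2) auto
      then show ?case using \<theta> by (simp add: powr_powr)
    qed
  qed
  have lower: "K/2 * real n powr \<theta> - B0 \<le> m n" if "n \<ge> 1" for n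
  proof -
    have "real n powr (\<theta>/2) \<le> real n powr \<theta>" using that \<theta> by (intro powr_mono) auto
    then have "K/2 * real n powr (\<theta>/2) \<le> K/2 * real n powr \<theta>" using K by (intro mult_left_mono) auto
    then show ?thesis using B0[of n] by (auto simp: abs_le_iff)
  qed
  have "filterlim (\<lambda>n. (- B0) + K/2 * real n powr \<theta>) at_top sequentially"
    using K by (intro filterlim_tendsto_add_at_top[OF tendsto_const] filterlim_tendsto_pos_mult_at_top[OF tendsto_const _ pw]) auto
  then have top: "filterlim m at_top sequentially"
    by (rule filterlim_at_top_mono) (use lower in \<open>auto simp: eventually_sequentially intro!: exI[of _ 1]\<close>)
  have sqrt_low: "\<forall>\<^sub>F n in sequentially. sqrt K / 2 * real n powr (\<theta>/2) \<le> sqrt (m n)"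
  proof -
    have "\<forall>\<^sub>F n in sequentially. 4 * B0 / K \<le> real n powr \<theta>" using pw by (simp add: filterlim_at_top)
    moreover have "\<forall>\<^sub>F n in sequentially. n \<ge> (1::nat)" by (rule eventually_ge_at_top)
    ultimately show ?thesis
    proof eventually_elim
      case (elim n)
      then have "K/4 * real n powr \<theta> \<le> m n" using lower[of n] K by (simp add: field_simps)
      then have "sqrt (K/4 * real n powr \<theta>) \<le> sqrt (m n)" by simp
      moreover have "sqrt (K/4 * real n powr \<theta>) = sqrt K / 2 * real n powr (\<theta>/2)"
        using K by (simp add: real_sqrt_mult real_sqrt_divide flip: half)
      ultimately show ?case by linarith
    qed
  qed
  define E where "E = (\<lambda>n t. \<bar>m (nat \<lfloor>real n * t\<rfloor>) - t powr \<theta> * m n\<bar>)"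
  have main: "\<forall>\<^sub>F n in sequentially. \<forall>t\<in>{0..1}. E n t \<le> \<epsilon> * sqrt (m n)" if \<epsilon>: "\<epsilon> > 0" for \<epsilon>
  proof -
    \<comment> \<open>By \<open>sqrt_low\<close>,
      \<open>2 * \<eta> * real n powr (\<theta>/2)\<close> uses up half of
      \<open>\<epsilon> * sqrt (m n)\<close>. The other half is for the constants
      \<open>2 * B + K\<close>: one \<open>B\<close> for each of the two means, \<open>K\<close> for
      rounding.\<close>
    define \<eta> where "\<eta> = \<epsilon> * sqrt K / 8"
    have \<eta>: "\<eta> > 0" using \<epsilon> K by (simp add: \<eta>_def)
    then obtain B where B: "\<And>n. \<bar>m n - K * real n powr \<theta>\<bar> \<le> \<eta> * real n powr (\<theta>/2) + B"
      using asym by blast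
    have E: "E n t \<le> 2 * \<eta> * real n powr (\<theta>/2) + (2 * B + K)" if t: "t \<in> {0..1}" for n t
    proof -
      define j where "j = nat \<lfloor>real n * t\<rfloor>"
      have t01: "0 \<le> t" "t \<le> 1" using t by auto
      have rj: "real j = of_int \<lfloor>real n * t\<rfloor>" using t01 by (simp add: j_def)
      have j: "real j \<le> real n * t" "real n * t < real j + 1" unfolding rj by linarith+
      have jn: "real j \<le> real n" using j(1) t01 mult_left_le[of t "real n"] by linarith
      have "\<bar>m j - K * real j powr \<theta>\<bar> \<le> \<eta> * real j powr (\<theta>/2) + B" by (rule B)
      moreover have "\<eta> * real j powr (\<theta>/2) \<le> \<eta> * real n powr (\<theta>/2)"
        using jn \<eta> \<theta> by (intro mult_left_mono powr_mono2) auto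
      ultimately have 1: "\<bar>m j - K * real j powr \<theta>\<bar> \<le> \<eta> * real n powr (\<theta>/2) + B" by linarith
      have T: "0 \<le> t powr \<theta>" "t powr \<theta> \<le> 1" using t01 \<theta> by (auto intro: powr_le1)
      have "\<bar>t powr \<theta> * m n - t powr \<theta> * (K * real n powr \<theta>)\<bar> = t powr \<theta> * \<bar>m n - K * real n powr \<theta>\<bar>"
        by (simp add: abs_mult flip: right_diff_distrib)
      also have "\<dots> \<le> 1 * (\<eta> * real n powr (\<theta>/2) + B)" using T B[of n] by (intro mult_mono) auto
      finally have 2: "\<bar>t powr \<theta> * m n - t powr \<theta> * (K * real n powr \<theta>)\<bar> \<le> \<eta> * real n powr (\<theta>/2) + B" by simp
      have tn: "t powr \<theta> * real n powr \<theta> = (real n * t) powr \<theta>" using t01 by (simp add: powr_mult mult.commute)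
      have "real j powr \<theta> \<le> (real n * t) powr \<theta>" using j \<theta> by (intro powr_mono2) auto
      moreover have "(real n * t) powr \<theta> \<le> real j powr \<theta> + 1"
      proof -
        have "(real n * t) powr \<theta> \<le> (real j + 1) powr \<theta>" using j \<theta> t01 by (intro powr_mono2) auto
        also have "\<dots> \<le> real j powr \<theta> + 1" using \<theta> by (intro powr_plus_one_le) auto
        finally show ?thesis .
      qed
      ultimately have "\<bar>real j powr \<theta> - t powr \<theta> * real n powr \<theta>\<bar> \<le> 1" unfolding tn by auto
      then have "K * \<bar>real j powr \<theta> - t powr \<theta> * real n powr \<theta>\<bar> \<le> K * 1" using K by (intro mult_left_mono) auto
      moreover have "K * \<bar>real j powr \<theta> - t powr \<theta> * real n powr \<theta>\<bar> = \<bar>K * real j powr \<theta> - t powr \<theta> * (K * real n powr \<theta>)\<bar>"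
        using K by (simp add: abs_mult_pos' algebra_simps)
      ultimately show ?thesis using 1 2 unfolding E_def j_def[symmetric] by linarith
    qed
    have "\<forall>\<^sub>F n in sequentially. (2 * (2 * B + K) / \<epsilon>)\<^sup>2 \<le> m n" using top by (simp add: filterlim_at_top)
    with sqrt_low show ?thesis
    proof eventually_elim
      case (elim n)
      have "2 * (2 * B + K) / \<epsilon> \<le> sqrt (m n)" using elim(2) by (rule real_le_rsqrt)
      then have 1: "2 * B + K \<le> \<epsilon> / 2 * sqrt (m n)" using \<epsilon> by (simp add: field_simps)
      have "2 * \<eta> * real n powr (\<theta>/2) = \<epsilon> / 2 * (sqrt K / 2 * real n powr (\<theta>/2))"
        by (simp add: \<eta>_def)
      also have "\<dots> \<le> \<epsilon> / 2 * sqrt (m n)" using elim(1) \<epsilon> by (intro mult_left_mono) auto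
      finally show ?case using E[of _ n] 1 by fastforce
    qed
  qed
  \<comment> \<open>The normalized supremum condenses \<open>main\<close>, a statement for each
    \<epsilon>, into one null sequence. The case \<epsilon> = 1 shows that the supremum is over a
    bounded set for large \<open>n\<close>.\<close>
  define b where "b = (\<lambda>n. (SUP t\<in>{0..1}. E n t) / sqrt (m n))"
  have pos: "\<forall>\<^sub>F n in sequentially. m n > 0" using top by (simp add: filterlim_at_top_dense)
  have E_le_SUP: "E n t \<le> (SUP t\<in>{0..1}. E n t)" if "\<forall>t\<in>{0..1}. E n t \<le> C" "t \<in> {0..1}" for n t C
    using that by (intro cSUP_upper) (auto intro!: bdd_aboveI[of _ C])
  have "b \<longlonglongrightarrow> 0"
  proof (rule tendstoI)
    fix e :: real assume e: "e > 0"
    have "\<forall>\<^sub>F n in sequentially. \<forall>t\<in>{0..1}. E n t \<le> e / 2 * sqrt (m n)" using e by (intro main) auto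
    with pos show "\<forall>\<^sub>F n in sequentially. dist (b n) 0 < e"
    proof eventually_elim
      case (elim n)
      have "(SUP t\<in>{0..1}. E n t) \<le> e / 2 * sqrt (m n)" using elim by (intro cSUP_least) auto
      then have "b n \<le> e / 2" using elim(1) by (simp add: b_def field_simps)
      moreover have "0 \<le> (SUP t\<in>{0..1}. E n t)"
        using E_le_SUP[OF elim(2), of 0] by (rule order_trans[rotated]) (auto simp: E_def)
      then have "0 \<le> b n" using elim(1) by (simp add: b_def)
      ultimately show ?case using e by simp
    qed
  qed
  moreover have "\<forall>\<^sub>F n in sequentially. \<forall>t\<in>{0..1}. E n t \<le> b n * sqrt (m n)"
    using main[of 1, simplified] pos
  proof eventually_elim
    case (elim n)
    then show ?case using E_le_SUP[OF elim(1)] by (simp add: b_def)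
  qed
  ultimately show ?thesis using that top unfolding E_def by blast
qed

text \<open>Both sides come from \<open>ln y \<le> y - 1\<close>, taken at \<open>1 + x\<close> and
  at its reciprocal. The estimate holds up to the singularity, and only a lower bound on
  \<open>1 + x\<close> has to be supplied.\<close>

lemma ln_one_plus_approx:
  fixes x :: real
  assumes "x > -1"
  shows "\<bar>ln (1 + x) - x\<bar> \<le> x\<^sup>2 / (1 + x)"
proof -
  have "ln (1 + x) \<le> x" using assms ln_le_minus_one[of "1 + x"] by simp
  moreover have "ln (1 / (1 + x)) \<le> 1 / (1 + x) - 1" using assms by (intro ln_le_minus_one) auto
  then have "- ln (1 + x) \<le> 1 / (1 + x) - 1" using assms by (simp add: ln_div)
  then have "x - ln (1 + x) \<le> x\<^sup>2 / (1 + x)" using assms by (simp add: field_simps power2_eq_square)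
  ultimately show ?thesis by simp
qed

text \<open>Here \<open>r\<close> is a count, \<mu> its mean, \<open>s\<close> the square root of
  \<open>m n\<close> and \<open>T = t powr \<theta>\<close>. The quotient of \<open>r\<close> by
  \<open>T * s ^ 2\<close> is \<open>1 + y + z\<close> with fluctuation \<open>y\<close> and bias
  \<open>z\<close>. The linear term in \<open>y\<close> is the one subtracted; what remains is
  quadratic in \<open>y\<close>, and linear or quadratic in \<open>z\<close>. The lower bound on
  \<open>r\<close> keeps \<open>1 + y + z\<close> above \<open>a / 2\<close>.\<close>

lemma log_linearization:
  fixes r \<mu> s a b T :: real
  assumes s: "s > 0" and a: "0 < a" "a \<le> T" "T \<le> 1" and b: "0 \<le> b" and r: "a / 2 * s\<^sup>2 \<le> r"
    and \<mu>: "\<bar>\<mu> - T * s\<^sup>2\<bar> \<le> b * s"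
  shows "\<bar>s * (ln r - ln (s\<^sup>2) - ln T) - (r - \<mu>) / (T * s)\<bar>
    \<le> 4 / (a ^ 3 * s ^ 3) * (r - \<mu>)\<^sup>2 + (4 * b\<^sup>2 / (a ^ 3 * s) + b / a)"
proof -
  define y where "y = (r - \<mu>) / (T * s\<^sup>2)"
  define z where "z = (\<mu> - T * s\<^sup>2) / (T * s\<^sup>2)"
  have T: "T > 0" using a by simp
  have r0: "r > 0" using r s a by (meson half_gt_zero mult_pos_pos order_less_le_trans zero_less_power)
  have yz: "1 + (y + z) = r / (T * s\<^sup>2)" using T s by (simp add: y_def z_def field_simps)
  have low: "a / 2 \<le> 1 + (y + z)"
  proof -
    have "a / 2 * (T * s\<^sup>2) \<le> a / 2 * (1 * s\<^sup>2)" using a T by (intro mult_left_mono mult_right_mono) auto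
    then have "a / 2 * (T * s\<^sup>2) \<le> r" using r by simp
    then show ?thesis unfolding yz using T s by (simp add: pos_le_divide_eq)
  qed
  have "\<bar>ln (1 + (y + z)) - (y + z)\<bar> \<le> (y + z)\<^sup>2 / (1 + (y + z))"
    by (rule ln_one_plus_approx) (use low a in linarith)
  also have "\<dots> \<le> (y + z)\<^sup>2 / (a / 2)" using low a by (intro divide_left_mono mult_pos_pos) auto
  also have "\<dots> \<le> (2 * y\<^sup>2 + 2 * z\<^sup>2) / (a / 2)"
    using a sum_squares_bound[of y z] by (intro divide_right_mono) (auto simp: power2_sum)
  finally have 1: "\<bar>ln (1 + (y + z)) - (y + z)\<bar> \<le> 4 * y\<^sup>2 / a + 4 * z\<^sup>2 / a" using a by (simp add: field_simps)
  have as: "0 < a * s\<^sup>2" "a * s\<^sup>2 \<le> T * s\<^sup>2" using a s by (auto intro: mult_right_mono)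
  have z: "\<bar>z\<bar> \<le> b / (a * s)"
  proof -
    have "\<bar>z\<bar> = \<bar>\<mu> - T * s\<^sup>2\<bar> / (T * s\<^sup>2)" using T s by (simp add: z_def abs_divide)
    also have "\<dots> \<le> (b * s) / (a * s\<^sup>2)" using \<mu> as b s by (intro frac_le) auto
    also have "\<dots> = b / (a * s)" using s by (simp add: power2_eq_square)
    finally show ?thesis .
  qed
  have z2: "z\<^sup>2 \<le> b\<^sup>2 / (a\<^sup>2 * s\<^sup>2)"
    using power_mono[OF z, of 2] by (simp add: power_divide power_mult_distrib)
  have y: "\<bar>y\<bar> \<le> \<bar>r - \<mu>\<bar> / (a * s\<^sup>2)"
    using T s as by (simp add: y_def abs_divide) (intro divide_left_mono mult_pos_pos, use a in auto)
  have y2: "y\<^sup>2 \<le> (r - \<mu>)\<^sup>2 / (a\<^sup>2 * s ^ 4)"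
    using power_mono[OF y, of 2] by (simp add: power_divide power_mult_distrib)
  have "ln r - ln (s\<^sup>2) - ln T = ln (1 + (y + z))"
    unfolding yz using r0 T s by (simp add: ln_div ln_mult)
  moreover have "(r - \<mu>) / (T * s) = s * y" using s T by (simp add: y_def power2_eq_square)
  ultimately have "s * (ln r - ln (s\<^sup>2) - ln T) - (r - \<mu>) / (T * s) = s * ((ln (1 + (y + z)) - (y + z)) + z)"
    by (simp add: algebra_simps)
  also have "\<bar>\<dots>\<bar> = s * \<bar>(ln (1 + (y + z)) - (y + z)) + z\<bar>" using s by (simp add: abs_mult)
  also have "\<dots> \<le> s * ((4 * y\<^sup>2 / a + 4 * z\<^sup>2 / a) + \<bar>z\<bar>)" using s 1 by (intro mult_left_mono) auto
  also have "\<dots> \<le> s * ((4 * ((r - \<mu>)\<^sup>2 / (a\<^sup>2 * s ^ 4)) / a + 4 * (b\<^sup>2 / (a\<^sup>2 * s\<^sup>2)) / a) + b / (a * s))"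
    using s a z z2 y2 by (intro mult_left_mono add_mono divide_right_mono) auto
  also have "\<dots> = 4 / (a ^ 3 * s ^ 3) * (r - \<mu>)\<^sup>2 + (4 * b\<^sup>2 / (a ^ 3 * s) + b / a)"
    using s a by (simp add: field_simps power2_eq_square power3_eq_cube power4_eq_xxxx)
  finally show ?thesis .
qed

section \<open>Integration against finitely many atoms plus a bounded density\<close>

definition mixed_integral :: "real set \<Rightarrow> (real \<Rightarrow> real) \<Rightarrow> (real \<Rightarrow> real) \<Rightarrow> (real \<Rightarrow> real) \<Rightarrow> real" where
  "mixed_integral J w g f = (\<Sum>t\<in>J. f t * w t) + (LINT t|lborel. f t * g t)"

text \<open>The conditions are stable under passing to absolute values of \<open>w\<close> and
  \<open>g\<close>, so the same facts apply to the signed measure and to its total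
  variation.\<close>

locale mixed_density =
  fixes J :: "real set" and w g :: "real \<Rightarrow> real" and B \<delta> :: real
  assumes finJ: "finite J" and J\<delta>: "J \<subseteq> {\<delta>..1}" and \<delta>: "0 < \<delta>" "\<delta> < 1"
    and gmeas [measurable]: "g \<in> borel_measurable borel"
    and gB: "\<And>t. \<bar>g t\<bar> \<le> B * indicator {\<delta>..1} t"
begin

text \<open>Boundedness is asked on [\<delta>, 1] only, where the measure lives; so
  \<open>ln\<close> and negative powers qualify despite their singularity at 0.\<close>

definition admits :: "(real \<Rightarrow> real) \<Rightarrow> bool" where
  "admits f \<longleftrightarrow> f \<in> borel_measurable borel \<and> (\<exists>C. \<forall>t\<in>{\<delta>..1}. \<bar>f t\<bar> \<le> C)"

lemma g_outside: "t \<notin> {\<delta>..1} \<Longrightarrow> g t = 0"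
  using gB[of t] by (auto simp: indicator_def)

lemma admits_integrable:
  assumes "admits f"
  shows "integrable lborel (\<lambda>t. f t * g t)"
proof -
  obtain C where C: "\<And>t. t \<in> {\<delta>..1} \<Longrightarrow> \<bar>f t\<bar> \<le> C" and f [measurable]: "f \<in> borel_measurable borel"
    using assms unfolding admits_def by blast
  have "0 \<le> \<bar>f 1\<bar>" by simp
  also have "\<dots> \<le> C" using C \<delta> by simp
  finally have C0: "0 \<le> C" .
  show ?thesis
  proof (rule Bochner_Integration.integrable_bound[of _ "\<lambda>t. (C * B) * indicator {\<delta>..1} t"])
    show "integrable lborel (\<lambda>t. (C * B) * indicator {\<delta>..1} t)"
      by (intro integrable_mult_right integrable_real_indicator) (use \<delta> in auto)
    have "norm (f t * g t) \<le> norm ((C * B) * indicator {\<delta>..1} t)" for t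
    proof (cases "t \<in> {\<delta>..1}")
      case True
      have "\<bar>f t\<bar> * \<bar>g t\<bar> \<le> C * B" using True C[OF True] gB[of t] C0 by (intro mult_mono) auto
      also have "\<dots> \<le> \<bar>C * B\<bar>" by (rule abs_ge_self)
      finally show ?thesis using True by (simp add: abs_mult)
    qed (simp add: g_outside)
    then show "AE t in lborel. norm (f t * g t) \<le> norm ((C * B) * indicator {\<delta>..1} t)" by simp
  qed simp
qed

lemma admits_lin:
  assumes "admits f" "admits h"
  shows "admits (\<lambda>t. a * f t + b * h t)"
proof -
  obtain C D where C: "\<And>t. t \<in> {\<delta>..1} \<Longrightarrow> \<bar>f t\<bar> \<le> C" "\<And>t. t \<in> {\<delta>..1} \<Longrightarrow> \<bar>h t\<bar> \<le> D"
    using assms unfolding admits_def by metis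
  have "\<bar>a * f t + b * h t\<bar> \<le> \<bar>a\<bar> * C + \<bar>b\<bar> * D" if "t \<in> {\<delta>..1}" for t
  proof -
    have "\<bar>a * f t + b * h t\<bar> \<le> \<bar>a\<bar> * \<bar>f t\<bar> + \<bar>b\<bar> * \<bar>h t\<bar>"
      using abs_triangle_ineq[of "a * f t" "b * h t"] by (simp add: abs_mult)
    also have "\<dots> \<le> \<bar>a\<bar> * C + \<bar>b\<bar> * D" using C[OF that] by (intro add_mono mult_left_mono) auto
    finally show ?thesis .
  qed
  moreover have "(\<lambda>t. a * f t + b * h t) \<in> borel_measurable borel"
    using assms unfolding admits_def by (intro borel_measurable_add borel_measurable_times) auto
  ultimately show ?thesis unfolding admits_def by blast
qed

lemma admits_mult:
  assumes "admits f" "admits h"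
  shows "admits (\<lambda>t. f t * h t)"
proof -
  obtain C D where C: "\<And>t. t \<in> {\<delta>..1} \<Longrightarrow> \<bar>f t\<bar> \<le> C" "\<And>t. t \<in> {\<delta>..1} \<Longrightarrow> \<bar>h t\<bar> \<le> D"
    using assms unfolding admits_def by metis
  have "\<bar>f t * h t\<bar> \<le> C * D" if "t \<in> {\<delta>..1}" for t
    unfolding abs_mult using C[OF that] by (intro mult_mono) (auto intro: order_trans[OF abs_ge_zero])
  moreover have "(\<lambda>t. f t * h t) \<in> borel_measurable borel"
    using assms unfolding admits_def by (intro borel_measurable_times) auto
  ultimately show ?thesis unfolding admits_def by blast
qed

lemma admits_const: "admits (\<lambda>_. a)"
  unfolding admits_def by auto

lemma admits_ln: "admits ln"
proof -
  have "\<bar>ln t\<bar> \<le> - ln \<delta>" if "t \<in> {\<delta>..1}" for t :: real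
    using that \<delta> ln_mono[of \<delta> t] ln_le_zero_iff[of t] by auto
  then have "\<exists>C. \<forall>t\<in>{\<delta>..1}. \<bar>ln t\<bar> \<le> C" by blast
  then show ?thesis unfolding admits_def by simp
qed

lemma admits_powr: "admits (\<lambda>t. t powr a)"
proof -
  have "continuous_on {\<delta>..1} (\<lambda>t. t powr a)" using \<delta> by (intro continuous_intros) auto
  then have "compact ((\<lambda>t. t powr a) ` {\<delta>..1})" by (intro compact_continuous_image) auto
  then obtain C where "\<forall>x\<in>(\<lambda>t. t powr a) ` {\<delta>..1}. norm x \<le> C" using compact_imp_bounded bounded_iff by metis
  then show ?thesis unfolding admits_def by auto
qed

lemma floor_le: "t \<in> {\<delta>..1} \<Longrightarrow> nat \<lfloor>real n * t\<rfloor> \<le> n"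
  using \<delta> mult_left_le[of t "real n"] by (auto simp: nat_le_iff floor_le_iff)

lemma admits_floor: "admits (\<lambda>t. c (nat \<lfloor>real n * t\<rfloor>))"
proof -
  have "(\<lambda>t::real. nat \<lfloor>real n * t\<rfloor>) \<in> measurable borel (count_space UNIV)" by measurable
  then have "(\<lambda>t. c (nat \<lfloor>real n * t\<rfloor>)) \<in> borel_measurable borel" by (rule measurable_compose) simp
  moreover have "\<bar>c (nat \<lfloor>real n * t\<rfloor>)\<bar> \<le> (\<Sum>j\<le>n. \<bar>c j\<bar>)" if "t \<in> {\<delta>..1}" for t
    using floor_le[OF that, of n] by (intro member_le_sum[of _ _ "\<lambda>j. \<bar>c j\<bar>"]) auto
  ultimately show ?thesis unfolding admits_def by blast
qed

abbreviation "L \<equiv> mixed_integral J w g"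

lemma L_cong: "(\<And>t. t \<in> {\<delta>..1} \<Longrightarrow> f t = h t) \<Longrightarrow> L f = L h"
proof -
  assume eq: "\<And>t. t \<in> {\<delta>..1} \<Longrightarrow> f t = h t"
  have "(\<lambda>t. f t * g t) = (\<lambda>t. h t * g t)"
    by (rule ext, case_tac "t \<in> {\<delta>..1}") (use eq g_outside in auto)
  moreover have "(\<Sum>t\<in>J. f t * w t) = (\<Sum>t\<in>J. h t * w t)" using eq J\<delta> by (intro sum.cong) auto
  ultimately show ?thesis by (simp add: mixed_integral_def)
qed

lemma L_lin: "admits f \<Longrightarrow> admits h \<Longrightarrow> L (\<lambda>t. a * f t + b * h t) = a * L f + b * L h"
  using admits_integrable[of f] admits_integrable[of h]
  by (simp add: mixed_integral_def sum_distrib_left sum.distrib algebra_simps)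

lemma L_sum:
  assumes "finite I" "\<And>i. i \<in> I \<Longrightarrow> admits (f i)"
  shows "admits (\<lambda>t. \<Sum>i\<in>I. a i * f i t) \<and> L (\<lambda>t. \<Sum>i\<in>I. a i * f i t) = (\<Sum>i\<in>I. a i * L (f i))"
  using assms
proof (induction I rule: finite_induct)
  case empty
  show ?case using admits_const[of 0] by (simp add: mixed_integral_def)
next
  case (insert x I)
  then show ?case
    using admits_lin[of "f x" "\<lambda>t. \<Sum>i\<in>I. a i * f i t" "a x" 1] L_lin[of "f x" "\<lambda>t. \<Sum>i\<in>I. a i * f i t" "a x" 1]
    by simp
qed

text \<open>For fixed \<open>n\<close> the integral is a finite combination of the values
  \<open>c j\<close> with weights that do not depend on \<open>c\<close>. When \<open>c\<close> is
  random, measurability, integrability and expectation thus follow from linearity.\<close>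

lemma L_floor:
  "L (\<lambda>t. c (nat \<lfloor>real n * t\<rfloor>)) = (\<Sum>j\<le>n. c j * L (\<lambda>t. if nat \<lfloor>real n * t\<rfloor> = j then 1 else 0))"
proof -
  have "L (\<lambda>t. c (nat \<lfloor>real n * t\<rfloor>)) = L (\<lambda>t. \<Sum>j\<le>n. c j * (if nat \<lfloor>real n * t\<rfloor> = j then 1 else 0))"
    by (rule L_cong) (use floor_le in \<open>auto simp: if_distrib[of "(*) _"] cong: if_cong\<close>)
  also have "\<dots> = (\<Sum>j\<le>n. c j * L (\<lambda>t. if nat \<lfloor>real n * t\<rfloor> = j then 1 else 0))"
    using admits_floor[of "\<lambda>k. if k = _ then 1 else 0" n] by (intro L_sum[THEN conjunct2]) auto
  finally show ?thesis .
qed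

lemma abs_mixed_density: "mixed_density J (\<lambda>t. \<bar>g t\<bar>) B \<delta>"
  by unfold_locales (use finJ J\<delta> \<delta> gB in auto)

lemma abs_L_le:
  assumes f: "admits f" and h: "admits h" and le: "\<And>t. t \<in> {\<delta>..1} \<Longrightarrow> \<bar>f t\<bar> \<le> h t"
  shows "\<bar>L f\<bar> \<le> mixed_integral J (\<lambda>t. \<bar>w t\<bar>) (\<lambda>t. \<bar>g t\<bar>) h"
proof -
  interpret V: mixed_density J "\<lambda>t. \<bar>w t\<bar>" "\<lambda>t. \<bar>g t\<bar>" B \<delta> by (rule abs_mixed_density)
  have "\<bar>\<Sum>t\<in>J. f t * w t\<bar> \<le> (\<Sum>t\<in>J. h t * \<bar>w t\<bar>)"
    by (rule order_trans[OF sum_abs]) (use le J\<delta> in \<open>auto simp: abs_mult intro!: sum_mono mult_right_mono\<close>)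
  moreover have "norm (LINT t|lborel. f t * g t) \<le> (LINT t|lborel. h t * \<bar>g t\<bar>)"
  proof (intro Bochner_Integration.integral_norm_bound_integral admits_integrable f V.admits_integrable h)
    show "norm (f t * g t) \<le> h t * \<bar>g t\<bar>" for t
      using le[of t] g_outside[of t] by (cases "t \<in> {\<delta>..1}") (auto simp: abs_mult intro: mult_right_mono)
  qed
  ultimately show ?thesis unfolding mixed_integral_def real_norm_def by linarith
qed

end

lemma mixed_integral_nonneg:
  "(\<And>t. 0 \<le> w t) \<Longrightarrow> (\<And>t. 0 \<le> g t) \<Longrightarrow> (\<And>t. 0 \<le> f t) \<Longrightarrow> 0 \<le> mixed_integral J w g f"
  unfolding mixed_integral_def by (intro add_nonneg_nonneg sum_nonneg integral_nonneg_AE) auto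

text \<open>Since the counts increase with the index, one lower bound at time \<open>\<lfloor>n \<delta>\<rfloor>\<close> keeps the arguments of all
  logarithms away from zero simultaneously, so no maximal inequality is needed: the quadratic
  remainder only enters through its integral, which has a small expectation.\<close>
lemma (in prob_space) log_functional_delta_method:
  fixes N :: "nat \<Rightarrow> 'a \<Rightarrow> nat" and \<theta> :: real
  assumes N_meas: "\<And>j. (\<lambda>\<omega>. real (N j \<omega>)) \<in> borel_measurable M"
    and N_le: "\<And>j \<omega>. N j \<omega> \<le> j" and N_mono: "\<And>j k \<omega>. j \<le> k \<Longrightarrow> N j \<omega> \<le> N k \<omega>"
    and N_var: "\<And>j. variance (\<lambda>\<omega>. real (N j \<omega>)) \<le> expectation (\<lambda>\<omega>. real (N j \<omega>))"
    and m_def: "m = (\<lambda>j. expectation (\<lambda>\<omega>. real (N j \<omega>)))"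
    and \<theta>: "0 < \<theta>"
    and b0: "b \<longlonglongrightarrow> 0"
    and bias: "\<forall>\<^sub>F n in sequentially. \<forall>t\<in>{0..1}. \<bar>m (nat \<lfloor>real n * t\<rfloor>) - t powr \<theta> * m n\<bar> \<le> b n * sqrt (m n)"
    and m_top: "filterlim m at_top sequentially"
    and dens: "mixed_density J g B \<delta>"
    and L1: "mixed_integral J w g (\<lambda>_. 1) = 0" and Lln: "mixed_integral J w g ln = 1"
    and \<epsilon>: "\<epsilon> > 0"
  shows "(\<lambda>n. prob {\<omega> \<in> space M. \<bar>sqrt (m n) * (mixed_integral J w g (\<lambda>t. logp (real (N (nat \<lfloor>real n * t\<rfloor>) \<omega>))) - \<theta>)
       - mixed_integral J w g (\<lambda>t. t powr (-\<theta>) * ((real (N (nat \<lfloor>real n * t\<rfloor>) \<omega>) - m (nat \<lfloor>real n * t\<rfloor>)) / sqrt (m n)))\<bar> > \<epsilon>})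
     \<longlonglongrightarrow> 0"
proof -
  interpret mixed_density J w g B \<delta> by (rule dens)
  interpret V: mixed_density J "\<lambda>t. \<bar>w t\<bar>" "\<lambda>t. \<bar>g t\<bar>" B \<delta> by (rule abs_mixed_density)
  note [measurable] = N_meas
  define R where "R = (\<lambda>j \<omega>. real (N j \<omega>))"
  have R_meas [measurable]: "R j \<in> borel_measurable M" for j unfolding R_def by simp
  have R_int: "integrable M (R j)" for j
    by (rule integrable_const_bound[of _ "real j"]) (use N_le[of j] in \<open>auto simp: R_def\<close>)
  have R2_int: "integrable M (\<lambda>\<omega>. (R j \<omega>)\<^sup>2)" for j
    by (rule integrable_const_bound[of _ "(real j)\<^sup>2"]) (use N_le[of j] in \<open>auto simp: R_def\<close>)
  have m: "m j = expectation (R j)" for j by (simp add: m_def R_def)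
  have var_int: "integrable M (\<lambda>\<omega>. (R j \<omega> - m j)\<^sup>2)" for j
    unfolding power2_diff by (intro Bochner_Integration.integrable_add Bochner_Integration.integrable_diff R2_int) (auto intro: R_int)
  have var: "expectation (\<lambda>\<omega>. (R j \<omega> - m j)\<^sup>2) \<le> m j" for j using N_var[of j] by (simp add: m R_def)
  have m_mono: "m j \<le> m k" if "j \<le> k" for j k
    unfolding m by (intro integral_mono R_int) (use N_mono[OF that] in \<open>auto simp: R_def\<close>)

  \<comment> \<open>The least value of \<open>t powr \<theta>\<close> on [\<delta>, 1].\<close>
  define a where "a = \<delta> powr \<theta>"
  have a: "0 < a" "a \<le> 1" using \<delta> \<theta> by (auto simp: a_def intro: powr_le1)
  define W where "W = V.L (\<lambda>_. 1)"
  define \<rho> where "\<rho> = (\<lambda>n j. V.L (\<lambda>t. if nat \<lfloor>real n * t\<rfloor> = j then 1 else 0))"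
  have \<rho>: "0 \<le> \<rho> n j" for n j unfolding \<rho>_def by (intro mixed_integral_nonneg) auto
  have W: "0 \<le> W" unfolding W_def by (intro mixed_integral_nonneg) auto
  have \<rho>_sum: "(\<Sum>j\<le>n. \<rho> n j) = W" for n
    using V.L_floor[of "\<lambda>_. 1" n] by (simp add: W_def \<rho>_def)
  define Q where "Q = (\<lambda>n \<omega>. V.L (\<lambda>t. (R (nat \<lfloor>real n * t\<rfloor>) \<omega> - m (nat \<lfloor>real n * t\<rfloor>))\<^sup>2))"
  have Q_eq: "Q n \<omega> = (\<Sum>j\<le>n. \<rho> n j * (R j \<omega> - m j)\<^sup>2)" for n \<omega>
    using V.L_floor[of "\<lambda>j. (R j \<omega> - m j)\<^sup>2" n] by (simp add: Q_def \<rho>_def mult.commute)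
  have Q_int: "integrable M (Q n)" for n
    unfolding Q_eq by (intro Bochner_Integration.integrable_sum integrable_mult_right var_int)
  have Q_nonneg: "0 \<le> Q n \<omega>" for n \<omega> unfolding Q_eq using \<rho> by (intro sum_nonneg) auto
  have Q_exp: "expectation (Q n) \<le> W * m n" for n
  proof -
    have "expectation (Q n) = (\<Sum>j\<le>n. \<rho> n j * expectation (\<lambda>\<omega>. (R j \<omega> - m j)\<^sup>2))"
      unfolding Q_eq using var_int by (subst Bochner_Integration.integral_sum) auto
    also have "\<dots> \<le> (\<Sum>j\<le>n. \<rho> n j * m n)"
      using \<rho> by (intro sum_mono mult_left_mono order_trans[OF var m_mono]) auto
    also have "\<dots> = W * m n" by (simp add: \<rho>_sum flip: sum_distrib_right)
    finally show ?thesis .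
  qed

  \<comment> \<open>Out of \<open>a * m n\<close>, one quarter is given up to the bias at \<delta>
    and one quarter to the fluctuation. The remaining half is the lower bound required by
    \<open>log_linearization\<close>.\<close>
  define Bad where "Bad = (\<lambda>n. {\<omega> \<in> space M. a / 4 * m n \<le> \<bar>R (nat \<lfloor>real n * \<delta>\<rfloor>) \<omega> - m (nat \<lfloor>real n * \<delta>\<rfloor>)\<bar>})"
  \<comment> \<open>By \<open>Q_exp\<close> the product \<open>c n * Q n\<close> has expectation at
    most a constant times \<open>inverse (sqrt (m n))\<close>; \<open>d n\<close> is the nonrandom
    remainder caused by the bias.\<close>
  define c where "c = (\<lambda>n. 4 / (a ^ 3 * sqrt (m n) ^ 3))"
  define d where "d = (\<lambda>n. (4 * (b n)\<^sup>2 / (a ^ 3 * sqrt (m n)) + b n / a) * W)"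
  have sqrt_top: "filterlim (\<lambda>n. sqrt (m n)) at_top sequentially"
    by (rule filterlim_compose[OF sqrt_at_top m_top])
  have inv0: "(\<lambda>n. inverse (sqrt (m n))) \<longlonglongrightarrow> 0" "(\<lambda>n. inverse (m n)) \<longlonglongrightarrow> 0"
    by (rule filterlim_compose[OF tendsto_inverse_0_at_top[OF filterlim_ident]] sqrt_top m_top)+
  have "d \<longlonglongrightarrow> (4 * 0\<^sup>2 / a ^ 3 * 0 + 0 / a) * W"
    unfolding d_def divide_inverse[of "4 * _"] inverse_mult_distrib mult.assoc[symmetric]
    using b0 inv0 a by (intro tendsto_intros) auto
  then have "d \<longlonglongrightarrow> 0" by simp
  then have d_small: "\<forall>\<^sub>F n in sequentially. d n < \<epsilon> / 2" using \<epsilon> by (intro order_tendstoD) auto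
  have "(\<lambda>n. b n * inverse (sqrt (m n))) \<longlonglongrightarrow> 0 * 0" using b0 inv0 by (intro tendsto_intros)
  then have b_small: "\<forall>\<^sub>F n in sequentially. b n * inverse (sqrt (m n)) < a / 4"
    using a by (intro order_tendstoD) auto
  have m_pos: "\<forall>\<^sub>F n in sequentially. m n > 0" using m_top by (simp add: filterlim_at_top_dense)

  define stat where "stat = (\<lambda>n \<omega>. sqrt (m n) * (L (\<lambda>t. logp (R (nat \<lfloor>real n * t\<rfloor>) \<omega>)) - \<theta>)
       - L (\<lambda>t. t powr (-\<theta>) * ((R (nat \<lfloor>real n * t\<rfloor>) \<omega> - m (nat \<lfloor>real n * t\<rfloor>)) / sqrt (m n))))"
  have upper: "\<forall>\<^sub>F n in sequentially. prob {\<omega> \<in> space M. \<bar>stat n \<omega>\<bar> > \<epsilon>}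
      \<le> 16 / a\<^sup>2 * inverse (m n) + 8 * W / (a ^ 3 * \<epsilon>) * inverse (sqrt (m n))"
    using bias d_small b_small m_pos
  proof eventually_elim
    case (elim n)
    define s where "s = sqrt (m n)"
    have s: "s > 0" "s\<^sup>2 = m n" using elim by (auto simp: s_def)
    have b_nonneg: "0 \<le> b n"
    proof -
      have "0 \<le> b n * s" using elim(1)[rule_format, of 1] by (auto simp: s_def intro: order_trans[OF abs_ge_zero])
      then show ?thesis using s by (simp add: zero_le_mult_iff)
    qed
    have good: "\<bar>stat n \<omega>\<bar> \<le> c n * Q n \<omega> + d n" if \<omega>: "\<omega> \<in> space M" "\<omega> \<notin> Bad n" for \<omega>
    proof -
      define r where "r = (\<lambda>t. R (nat \<lfloor>real n * t\<rfloor>) \<omega>)"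
      define \<mu> where "\<mu> = (\<lambda>t. m (nat \<lfloor>real n * t\<rfloor>))"
      have low: "a / 2 * s\<^sup>2 \<le> r t" if t: "t \<in> {\<delta>..1}" for t
      proof -
        have "\<bar>\<mu> \<delta> - a * m n\<bar> \<le> b n * s" using elim(1) \<delta> by (simp add: \<mu>_def a_def s_def)
        moreover have "b n * s \<le> a / 4 * m n"
        proof -
          have "b n \<le> a / 4 * s" using elim(3) s by (simp add: s_def field_simps)
          then have "b n * s \<le> a / 4 * s * s" using s by (intro mult_right_mono) auto
          also have "a / 4 * s * s = a / 4 * m n" unfolding s(2)[symmetric] by (simp add: power2_eq_square)
          finally show ?thesis .
        qed
        moreover have "\<bar>r \<delta> - \<mu> \<delta>\<bar> < a / 4 * m n" using \<omega> by (auto simp: Bad_def r_def \<mu>_def)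
        ultimately have "a / 2 * m n \<le> r \<delta>" by linarith
        also have "\<dots> \<le> r t" unfolding r_def R_def
          using t by (intro of_nat_mono N_mono nat_mono floor_mono mult_left_mono) auto
        finally show ?thesis using s by simp
      qed
      have logp_eq: "logp (r t) = ln (r t)" if t: "t \<in> {\<delta>..1}" for t
      proof -
        have "0 < a / 2 * s\<^sup>2" using a(1) s(1) by simp
        then have "0 < r t" using low[OF t] by linarith
        \<comment> \<open>A positive count is at least 1, so the truncation in \<open>logp\<close>
          has no effect.\<close>
        then have "1 \<le> r t" by (simp add: r_def R_def)
        then show ?thesis by (simp add: logp_def)
      qed
      define D where "D = (\<lambda>t. s * (ln (r t) - ln (s\<^sup>2) - \<theta> * ln t) - t powr (-\<theta>) * ((r t - \<mu> t) / s))"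
      have adm_r: "admits (\<lambda>t. F (r t))" for F :: "real \<Rightarrow> real"
        unfolding r_def using admits_floor[of "\<lambda>j. F (R j \<omega>)" n] .
      have adm_Z: "admits (\<lambda>t. t powr (-\<theta>) * ((r t - \<mu> t) / s))"
        unfolding r_def \<mu>_def using admits_floor[of "\<lambda>j. (R j \<omega> - m j) / s" n] 
        by (intro admits_mult admits_powr)
      \<comment> \<open>The explicit factors match the shape of \<open>L_lin\<close>. Under
        \<open>L\<close> the term \<open>ln (s\<^sup>2)\<close> disappears by \<open>L1\<close>, and
        \<open>\<theta> * ln t\<close> becomes \<theta> by \<open>Lln\<close>.\<close>
      define F where "F = (\<lambda>t. 1 * ln (r t) + (-1) * (ln (s\<^sup>2) * 1 + \<theta> * ln t))"
      have adm_c: "admits (\<lambda>t. ln (s\<^sup>2) * 1 + \<theta> * ln t)" by (intro admits_lin admits_const admits_ln)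
      have adm_F: "admits F" unfolding F_def by (intro admits_lin[where f="\<lambda>t. ln (r t)"] adm_r adm_c)
      have D_eq: "D = (\<lambda>t. s * F t + (-1) * (t powr (-\<theta>) * ((r t - \<mu> t) / s)))"
        by (auto simp: D_def F_def)
      have adm_D: "admits D" unfolding D_eq by (intro admits_lin adm_F adm_Z)
      have "L F = 1 * L (\<lambda>t. ln (r t)) + (-1) * L (\<lambda>t. ln (s\<^sup>2) * 1 + \<theta> * ln t)"
        unfolding F_def by (intro L_lin adm_r adm_c)
      also have "L (\<lambda>t. ln (s\<^sup>2) * 1 + \<theta> * ln t) = ln (s\<^sup>2) * L (\<lambda>_. 1) + \<theta> * L ln"
        by (intro L_lin admits_const admits_ln)
      finally have "L F = L (\<lambda>t. ln (r t)) - \<theta>" using L1 Lln by simp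
      moreover have "L (\<lambda>t. ln (r t)) = L (\<lambda>t. logp (r t))" by (intro L_cong) (simp add: logp_eq)
      moreover have "L D = s * L F + (-1) * L (\<lambda>t. t powr (-\<theta>) * ((r t - \<mu> t) / s))"
        unfolding D_eq by (intro L_lin adm_F adm_Z)
      ultimately have stat: "stat n \<omega> = L D" by (simp add: stat_def r_def \<mu>_def s_def)
      define k where "k = 4 * (b n)\<^sup>2 / (a ^ 3 * s) + b n / a"
      have bound: "\<bar>D t\<bar> \<le> c n * (r t - \<mu> t)\<^sup>2 + k * 1" if t: "t \<in> {\<delta>..1}" for t
      proof -
        have t0: "0 < t" "t \<le> 1" "\<delta> \<le> t" using t \<delta> by auto
        have T: "a \<le> t powr \<theta>" "t powr \<theta> \<le> 1" using t0 \<theta> \<delta> by (auto simp: a_def intro: powr_mono2 powr_le1)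
        have "\<bar>\<mu> t - t powr \<theta> * s\<^sup>2\<bar> \<le> b n * s" using elim(1) t0 s by (simp add: \<mu>_def s_def)
        from log_linearization[OF s(1) a(1) T b_nonneg low[OF t] this]
        have "\<bar>s * (ln (r t) - ln (s\<^sup>2) - ln (t powr \<theta>)) - (r t - \<mu> t) / (t powr \<theta> * s)\<bar>
           \<le> c n * (r t - \<mu> t)\<^sup>2 + k" by (simp add: c_def s_def k_def)
        moreover have "ln (t powr \<theta>) = \<theta> * ln t" using t0 by (simp add: ln_powr)
        moreover have "(r t - \<mu> t) / (t powr \<theta> * s) = t powr (-\<theta>) * ((r t - \<mu> t) / s)"
          by (simp add: powr_minus divide_inverse)
        ultimately show ?thesis by (simp add: D_def)
      qed
      have adm_sq: "admits (\<lambda>t. (r t - \<mu> t)\<^sup>2)"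
        unfolding r_def \<mu>_def using admits_floor[of "\<lambda>j. (R j \<omega> - m j)\<^sup>2" n] .
      have "\<bar>L D\<bar> \<le> V.L (\<lambda>t. c n * (r t - \<mu> t)\<^sup>2 + k * 1)"
        by (rule abs_L_le[OF adm_D admits_lin[OF adm_sq admits_const] bound])
      also have "\<dots> = c n * V.L (\<lambda>t. (r t - \<mu> t)\<^sup>2) + k * V.L (\<lambda>_. 1)"
        by (rule V.L_lin[OF adm_sq admits_const])
      finally show ?thesis by (simp add: stat Q_def W_def r_def \<mu>_def d_def k_def s_def)
    qed
    have c_pos: "c n > 0" using a elim(4) by (simp add: c_def)
    have "prob {\<omega> \<in> space M. \<bar>stat n \<omega>\<bar> > \<epsilon>} \<le> prob (Bad n \<union> {\<omega> \<in> space M. Q n \<omega> \<ge> \<epsilon> / (2 * c n)})"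
    \<comment> \<open>A set outside the sigma-algebra has \<open>measure\<close> 0 by convention, so
      only the measurable case has content.\<close>
    proof (cases "{\<omega> \<in> space M. \<bar>stat n \<omega>\<bar> > \<epsilon>} \<in> events")
      case True
      show ?thesis
      proof (rule finite_measure_mono)
        show "Bad n \<union> {\<omega> \<in> space M. Q n \<omega> \<ge> \<epsilon> / (2 * c n)} \<in> events"
          unfolding Bad_def using Q_int[of n, THEN borel_measurable_integrable] by measurable
        show "{\<omega> \<in> space M. \<bar>stat n \<omega>\<bar> > \<epsilon>} \<subseteq> Bad n \<union> {\<omega> \<in> space M. Q n \<omega> \<ge> \<epsilon> / (2 * c n)}"
        proof
          fix \<omega> assume \<omega>: "\<omega> \<in> {\<omega> \<in> space M. \<bar>stat n \<omega>\<bar> > \<epsilon>}"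
          show "\<omega> \<in> Bad n \<union> {\<omega> \<in> space M. Q n \<omega> \<ge> \<epsilon> / (2 * c n)}"
          proof (cases "\<omega> \<in> Bad n")
            case False
            then have "\<epsilon> / 2 \<le> c n * Q n \<omega>" using good[of \<omega>] \<omega> elim(2) by auto
            then show ?thesis using \<omega> c_pos by (simp add: field_simps)
          qed simp
        qed
      qed
    qed (simp add: measure_notin_sets)
    also have "\<dots> \<le> prob (Bad n) + prob {\<omega> \<in> space M. Q n \<omega> \<ge> \<epsilon> / (2 * c n)}"
      by (rule measure_Un_le) 
        (use Q_int[of n, THEN borel_measurable_integrable] in \<open>auto simp: Bad_def\<close>)
    also have "prob (Bad n) \<le> 16 / a\<^sup>2 * inverse (m n)"
    proof -
      define j where "j = nat \<lfloor>real n * \<delta>\<rfloor>"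
      have jn: "j \<le> n" using floor_le[of \<delta> n] \<delta> by (simp add: j_def)
      have "prob (Bad n) \<le> variance (R j) / (a / 4 * m n)\<^sup>2"
        unfolding Bad_def j_def[symmetric] m[of j] using a elim(4) by (intro Chebyshev_inequality R2_int) auto
      also have "\<dots> \<le> m n / (a / 4 * m n)\<^sup>2"
        using var[of j] m_mono[OF jn] by (intro divide_right_mono) (auto simp: m)
      also have "\<dots> = 16 / a\<^sup>2 * inverse (m n)" using elim(4) a by (simp add: field_simps power2_eq_square)
      finally show ?thesis .
    qed
    also have "prob {\<omega> \<in> space M. Q n \<omega> \<ge> \<epsilon> / (2 * c n)} \<le> 8 * W / (a ^ 3 * \<epsilon>) * inverse (sqrt (m n))"
    proof -
      have "prob {\<omega> \<in> space M. Q n \<omega> \<ge> \<epsilon> / (2 * c n)} \<le> expectation (Q n) / (\<epsilon> / (2 * c n))"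
        using \<epsilon> c_pos by (intro integral_Markov_inequality_measure[OF Q_int, of "{}"]) (auto simp: Q_nonneg)
      also have "\<dots> \<le> W * m n / (\<epsilon> / (2 * c n))"
        using Q_exp \<epsilon> c_pos by (intro divide_right_mono) auto
      also have "\<dots> = 8 * W / (a ^ 3 * \<epsilon>) * inverse (sqrt (m n))"
        using s a \<epsilon> unfolding c_def s_def[symmetric] s(2)[symmetric] by (simp add: field_simps power2_eq_square power3_eq_cube)
      finally show ?thesis .
    qed
    finally show ?case by simp
  qed
  have "(\<lambda>n. 16 / a\<^sup>2 * inverse (m n) + 8 * W / (a ^ 3 * \<epsilon>) * inverse (sqrt (m n))) \<longlonglongrightarrow> 16 / a\<^sup>2 * 0 + 8 * W / (a ^ 3 * \<epsilon>) * 0"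
    by (intro tendsto_intros inv0)
  then have lim: "(\<lambda>n. 16 / a\<^sup>2 * inverse (m n) + 8 * W / (a ^ 3 * \<epsilon>) * inverse (sqrt (m n))) \<longlonglongrightarrow> 0"
    by simp
  have "(\<lambda>n. prob {\<omega> \<in> space M. \<bar>stat n \<omega>\<bar> > \<epsilon>}) \<longlonglongrightarrow> 0"
    by (rule tendsto_sandwich[OF _ upper tendsto_const lim]) simp
  then show ?thesis unfolding stat_def R_def .
qed

theorem theorem2p2:
  fixes M :: "'a measure" and X :: "nat \<Rightarrow> 'a \<Rightarrow> nat" and p :: "nat \<Rightarrow> real"
    and A :: "real \<Rightarrow> real" and \<theta> c \<delta> :: real
  assumes M: "prob_space M"
    and X_meas: "\<And>k. X k \<in> measurable M (count_space UNIV)"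
    and X_indep: "prob_space.indep_vars M (\<lambda>_. count_space UNIV) X UNIV"
    and X_distr: "\<And>k i. measure M {\<omega> \<in> space M. X k \<omega> = i} = p i"
    and p_pos: "\<And>i. i \<ge> 1 \<Longrightarrow> p i > 0"
    and p_sum: "(p has_sum 1) {1..}"
    and \<theta>: "0 < \<theta>" "\<theta> < 1"
    and c: "c > 0"
    and p_asymp: "(\<lambda>i. p i / (c * real i powr (-1/\<theta>)) - 1) \<in> o(\<lambda>i. real i powr (-1/2))"
    and A_adm: "admissible_weight A"
    and A_log: "LS_integral A ln = 1"
    and A_0: "A 0 = 0" and A_0r: "(A \<longlongrightarrow> 0) (at_right 0)" and A_1: "A 1 = 0"
    and \<delta>: "0 < \<delta>" "\<delta> < 1" and A_\<delta>: "\<forall>t\<in>{0..\<delta>}. A t = 0"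
  shows "\<forall>\<epsilon>>0. (\<lambda>n. measure M {\<omega> \<in> space M.
      \<bar>sqrt (integral\<^sup>L M (\<lambda>\<omega>. real (nwords X n \<omega>)))
          * (LS_integral A (\<lambda>t. logp (real (nwords X (nat \<lfloor>real n * t\<rfloor>) \<omega>))) - \<theta>)
        - LS_integral A (\<lambda>t. t powr (-\<theta>) *
            ((real (nwords X (nat \<lfloor>real n * t\<rfloor>) \<omega>)
              - integral\<^sup>L M (\<lambda>\<omega>'. real (nwords X (nat \<lfloor>real n * t\<rfloor>) \<omega>')))
             / sqrt (integral\<^sup>L M (\<lambda>\<omega>'. real (nwords X n \<omega>')))))\<bar> > \<epsilon>})
      \<longlonglongrightarrow> 0"
proof (intro allI impI)
  fix \<epsilon> :: real assume \<epsilon>: "\<epsilon> > 0"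
  interpret iid_words M X p
    using M X_meas X_indep X_distr p_sum by (rule iid_words.intro[OF _ iid_words_axioms.intro])
  define m where "m = (\<lambda>j. expectation (\<lambda>\<omega>. real (nwords X j \<omega>)))"
  have m0: "0 \<le> m n" for n unfolding m_def by (intro integral_nonneg_AE) auto
  obtain K where "K > 0" and
    K: "\<And>\<eta>. \<eta> > 0 \<Longrightarrow> \<exists>B. \<forall>n. \<bar>m n - K * real n powr \<theta>\<bar> \<le> \<eta> * real n powr (\<theta>/2) + B"
    unfolding m_def expectation_nwords
    by (rule expected_distinct_asymptotics[OF p_bounds summable_p \<theta> c p_asymp]) blast
  obtain b where b: "b \<longlonglongrightarrow> 0"
    "\<forall>\<^sub>F n in sequentially. \<forall>t\<in>{0..1}. \<bar>m (nat \<lfloor>real n * t\<rfloor>) - t powr \<theta> * m n\<bar> \<le> b n * sqrt (m n)"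
    "filterlim m at_top sequentially"
    by (rule regular_mean_uniform_bias[OF \<theta> \<open>K > 0\<close> m0 K])
  obtain J w g B where J: "finite J" "J \<subseteq> {\<delta>..1}" and g: "g \<in> borel_measurable borel"
    "\<And>t. \<bar>g t\<bar> \<le> B * indicator {\<delta>..1} t"
    and rep: "\<And>f. LS_integral A f = (\<Sum>t\<in>J. f t * w t) + (LINT t|lborel. f t * g t)"
    and zero: "(\<Sum>t\<in>J. w t) + (LINT t|lborel. g t) = 0"
    by (rule LS_integral_representation[OF A_adm A_0 A_1 A_0r \<delta> A_\<delta>]) blast
  have LS: "LS_integral A = mixed_integral J w g" by (rule ext) (simp add: rep mixed_integral_def)
  have dens: "mixed_density J g B \<delta>" by unfold_locales (use J \<delta> g in auto)
  have L1: "mixed_integral J w g (\<lambda>_. 1) = 0" using zero by (simp add: mixed_integral_def)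
  show "(\<lambda>n. measure M {\<omega> \<in> space M.
      \<bar>sqrt (integral\<^sup>L M (\<lambda>\<omega>. real (nwords X n \<omega>)))
          * (LS_integral A (\<lambda>t. logp (real (nwords X (nat \<lfloor>real n * t\<rfloor>) \<omega>))) - \<theta>)
        - LS_integral A (\<lambda>t. t powr (-\<theta>) *
            ((real (nwords X (nat \<lfloor>real n * t\<rfloor>) \<omega>)
              - integral\<^sup>L M (\<lambda>\<omega>'. real (nwords X (nat \<lfloor>real n * t\<rfloor>) \<omega>')))
             / sqrt (integral\<^sup>L M (\<lambda>\<omega>'. real (nwords X n \<omega>')))))\<bar> > \<epsilon>})
      \<longlonglongrightarrow> 0"
    using log_functional_delta_method[OF nwords_meas nwords_le nwords_mono variance_nwords_le m_def \<theta>(1) b dens L1 A_log[unfolded LS] \<epsilon>]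
    unfolding LS m_def .
qed

end
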